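(* Let $k\ge 0$ and suppose that - $f,g_1,\dots,g_m$ are $C^1$ vector functions, and - for all $i=1,\dots,m$, $w_i$ is the real constant function on $[t_k,t_{k+1}]$ given by $w_i=\frac1{h_k}\int_{t_k}^{t_{k+1}}v_i(t)\,dt$. Let $x$ and $y$ be solutions on $[t_k,t_{k+1}]$ of the input-affine system with inputs $v_i$ and of the auxiliary system with inputs $w_i$ respectively, with $x(t_k)=y(t_k)$. Then $$\|x(t_{k+1})-y(t_{k+1})\|\le h_k^2\Bigl((K+K')\,L'/3+2K'\,(L+L')\,\varphi(\Lambda h_k)\Bigr).$$
   Context: Setting. The input-affine system is $$\dot x(t)=f(x(t))+\sum_{i=1}^m g_i(x(t))\,v_i(t),$$ where $f,g_1,\dots,g_m:\mathbb{R}^n\to\mathbb{R}^n$ and each $v_i$ is an arbitrary measurable function with $v_i(t)\in[-V_i,V_i]$, $V_i>0$. Solutions are absolutely continuous functions satisfying the equation for almost every $t$. The interval $[0,T]$ is partitioned as $0=t_0<t_1<\dots<t_N=T$ and $h_k=t_{k+1}-t_k$. On $[t_k,t_{k+1}]$ the auxiliary system is $$\dot y(t)=f(y(t))+\sum_{i=1}^m g_i(y(t))\,w_i(t),\qquad y(t_k)=x(t_k).$$ Norms. $\|\cdot\|$ is the supremum norm on $\mathbb{R}^n$ and the induced matrix norm. The logarithmic norm of a square matrix $Q$ is $\lambda(Q)=\lim_{h\to0^+}(\|I+hQ\|-1)/h$, i.e. $\lambda(Q)=\max_k\{q_{kk}+\sum_{i\ne k}|q_{ki}|\}$. Bounds.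 $B\subset\mathbb{R}^n$ is a box containing the values on $[0,T]$ of all solutions under consideration of both systems (for all admissible inputs, including zero inputs). The constants satisfy, for all $z\in B$ and all $i$: $\|f(z)\|\le K$, $\|g_i(z)\|\le K_i$, $\lambda(Df(z))\le\Lambda$, $\|Df(z)\|\le L$, $\|Dg_i(z)\|\le L_i$, where $D$ denotes the Jacobian matrix. Put $K'=\sum_{i=1}^m V_iK_i$, $L'=\sum_{i=1}^m V_iL_i$, and $\varphi(s)=(e^s-1)/s$, with $\varphi(0)=1$. *)

theory Defs
  imports "HOL-Analysis.Analysis"
begin

text \<open>
  The supremum norm on \<open>real ^ 'n\<close> is \<^const>\<open>infnorm\<close>; the overloaded \<^const>\<open>norm\<close> is Euclidean
  on this type, so \<^const>\<open>onorm\<close> is not the matrix norm induced by the supremum norm. The point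
  \<open>x = 0\<close> contributes \<open>0 / 0 = 0\<close> to the supremum below and is harmless.
\<close>

definition mat_infnorm :: "real ^ 'n ^ 'n \<Rightarrow> real" where
  "mat_infnorm Q = (SUP x. infnorm (Q *v x) / infnorm x)"

definition log_norm :: "real ^ 'n ^ 'n \<Rightarrow> real" where
  "log_norm Q = Lim (at_right 0) (\<lambda>h. (mat_infnorm (mat 1 + h *\<^sub>R Q) - 1) / h)"

definition C1_vector_function :: "(real ^ 'n \<Rightarrow> real ^ 'n) \<Rightarrow> bool" where
  "C1_vector_function F \<longleftrightarrow>
     (\<forall>z. F differentiable (at z)) \<and> continuous_on UNIV (\<lambda>z. jacobian F (at z))"

definition absolutely_continuous_fun :: "real \<Rightarrow> real \<Rightarrow> (real \<Rightarrow> 'a::real_normed_vector) \<Rightarrow> bool" where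
  "absolutely_continuous_fun a b x \<longleftrightarrow>
     (\<forall>\<epsilon>>0. \<exists>\<delta>>0. \<forall>(I :: nat set) l u.
        finite I \<and> (\<forall>i\<in>I. a \<le> l i \<and> l i \<le> u i \<and> u i \<le> b) \<and>
        disjoint_family_on (\<lambda>i. {l i<..<u i}) I \<and> (\<Sum>i\<in>I. u i - l i) < \<delta>
        \<longrightarrow> (\<Sum>i\<in>I. norm (x (u i) - x (l i))) < \<epsilon>)"

definition admissible_inputs ::
  "real set \<Rightarrow> nat \<Rightarrow> (nat \<Rightarrow> real) \<Rightarrow> (nat \<Rightarrow> real \<Rightarrow> real) \<Rightarrow> bool" where
  "admissible_inputs S m V v \<longleftrightarrow>
     (\<forall>i\<in>{1..m}. v i \<in> borel_measurable (lebesgue_on S) \<and> (\<forall>s\<in>S. v i s \<in> {- V i..V i}))"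

definition input_affine_solution ::
  "(real ^ 'n \<Rightarrow> real ^ 'n) \<Rightarrow> nat \<Rightarrow> (nat \<Rightarrow> real ^ 'n \<Rightarrow> real ^ 'n) \<Rightarrow> (nat \<Rightarrow> real \<Rightarrow> real)
     \<Rightarrow> real \<Rightarrow> real \<Rightarrow> (real \<Rightarrow> real ^ 'n) \<Rightarrow> bool" where
  "input_affine_solution f m g v a b x \<longleftrightarrow>
     absolutely_continuous_fun a b x \<and>
     (AE s in lebesgue_on {a..b}.
        (x has_vector_derivative (f (x s) + (\<Sum>i=1..m. v i s *\<^sub>R g i (x s)))) (at s within {a..b}))"

definition phi :: "real \<Rightarrow> real" where
  "phi s = (if s = 0 then 1 else (exp s - 1) / s)"

end

theory Submission
  imports Defs
begin

text \<open>
  Write $h$ for the length of the step. The difference $x - y$ is estimated twice: crudely,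
  to first order in $h$, and then, feeding the crude estimate back in, to second order.

  \<^bold>\<open>First order.\<close> The vector $x - y$ moves with velocity $f(x) - f(y)$ plus the input terms,
  whose supremum norm is at most $2K'$. The logarithmic norm bounds how fast $f$ can push apart two
  points: in the coordinate in which $x - y$ is largest, the velocity $f(x) - f(y)$ points
  outwards with at most $\Lambda$ times the size of $x - y$
  (\<open>component_diff_le_one_sided_Lipschitz\<close>). Hence $\|x - y\|$ never exceeds the solution
  $2K' s\,\varphi(\Lambda s)$ of $\mu' = \Lambda\mu + 2K'$, $\mu(0) = 0$
  (\<open>infnorm_le_growth\<close>). This solution increases with $s$, also for $\Lambda < 0$, so it is at
  most $E = 2K' h\,\varphi(\Lambda h)$ on the whole step.

  \<^bold>\<open>Second order.\<close> Split
  \[ g_i(x) v_i - g_i(y) w_i = (g_i(x) - g_i(y))\, v_i + g_i(y)\,(v_i - w_i). \]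
  Together with $f(x) - f(y)$ the first terms have norm at most $(L + L') E$ by the mean value
  theorem, and integrate to at most $h (L + L') E$, which is the second summand of the bound.
  For the last term, $v_i - w_i$ has mean zero while $g_i \circ y$ is Lipschitz with constant
  $L_i (K + K')$. Integrating by parts moves the integral onto the primitive $U$ of
  $v_i - w_i$, which vanishes at both ends and satisfies $|U(s)| \le 2 V_i s (h - s) / h$;
  the integral of this parabola is $V_i h^2 / 3$, which gives the first summand
  (\<open>integral_Lipschitz_mult_centred\<close>).

  All of this rests on recovering a solution from its derivative. The derivative exists only almost
  everywhere, so the fundamental theorem of calculus is needed in its form for absolutely
  continuous functions (\<open>absolutely_continuous_has_integral_derivative\<close>).
\<close>

section \<open>The fundamental theorem of calculus for absolutely continuous functions\<close>

text \<open>
  The open intervals underlying a tagged division are disjoint, so the total length of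
  those lying in a small set is small. This is how a null set of tags is brought within reach of
  the $\delta$ of absolute continuity.
\<close>

lemma sum_length_tagged_division_le_measure:
  fixes U :: "real set"
  assumes p: "p tagged_division_of {a..b}" and "q \<subseteq> p"
    and U: "U \<in> lmeasurable" "\<And>s K. (s, K) \<in> q \<Longrightarrow> K \<subseteq> U"
  shows "disjoint_family_on (\<lambda>(s, K). {Inf K<..<Sup K}) q"
    and "(\<Sum>(s, K)\<in>q. Sup K - Inf K) \<le> measure lebesgue U"
proof -
  have K: "\<exists>u v. K = {u..v} \<and> u \<le> v" if "(s, K) \<in> q" for s K
  proof -
    have "(s, K) \<in> p" using that assms by auto
    then have "s \<in> K" "\<exists>u v. K = cbox u v"
      using tagged_division_ofD(2,4)[OF p] by blast+
    then show ?thesis by (metis atLeastAtMost_iff box_real(2) order_trans)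
  qed
  have int: "interior K = {Inf K<..<Sup K}" if "(s, K) \<in> q" for s K
    using K[OF that] by (auto simp: interior_atLeastAtMost_real)
  show disj: "disjoint_family_on (\<lambda>(s, K). {Inf K<..<Sup K}) q"
    unfolding disjoint_family_on_def
  proof (intro ballI impI)
    fix z z' assume z: "z \<in> q" "z' \<in> q" "z \<noteq> z'"
    obtain s K s' K' where zz: "z = (s, K)" "z' = (s', K')" by (cases z, cases z') blast
    then have q: "(s, K) \<in> q" "(s', K') \<in> q" "(s, K) \<noteq> (s', K')" using z by auto
    then have "interior K \<inter> interior K' = {}"
      using tagged_division_ofD(5)[OF p, of s K s' K'] \<open>q \<subseteq> p\<close> by auto
    then show "(case z of (s, K) \<Rightarrow> {Inf K<..<Sup K}) \<inter> (case z' of (s, K) \<Rightarrow> {Inf K<..<Sup K}) = {}"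
      using int q by (simp add: zz)
  qed
  have fin: "finite q" using p \<open>q \<subseteq> p\<close> by (meson finite_subset tagged_division_of_finite)
  have "(\<Sum>(s, K)\<in>q. Sup K - Inf K) = (\<Sum>z\<in>q. measure lebesgue ((\<lambda>(s, K). {Inf K<..<Sup K}) z))"
    by (rule sum.cong) (use K in force)+
  also have "\<dots> = measure lebesgue (\<Union>z\<in>q. (\<lambda>(s, K). {Inf K<..<Sup K}) z)"
  proof (rule measure_UNION'[symmetric, OF fin])
    show "pairwise (\<lambda>x y. disjnt (case x of (s, K) \<Rightarrow> {Inf K<..<Sup K}) (case y of (s, K) \<Rightarrow> {Inf K<..<Sup K})) q"
      using disj by (auto simp: pairwise_def disjnt_def disjoint_family_on_def)
  qed auto
  also have "\<dots> \<le> measure lebesgue U"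
  proof (rule measure_mono_fmeasurable[OF _ _ U(1)])
    show "(\<Union>z\<in>q. case z of (s, K) \<Rightarrow> {Inf K<..<Sup K}) \<subseteq> U"
      using U(2) K by fastforce
    show "(\<Union>z\<in>q. case z of (s, K) \<Rightarrow> {Inf K<..<Sup K}) \<in> sets lebesgue"
      using fin by (intro sets.finite_UN) auto
  qed
  finally show "(\<Sum>(s, K)\<in>q. Sup K - Inf K) \<le> measure lebesgue U" .
qed

text \<open>
  Indexing by an arbitrary type lets the condition be applied to the pairs
  in a tagged division without enumerating them at each use.
\<close>

lemma absolutely_continuous_fun_finite_familyE:
  assumes "absolutely_continuous_fun a b x" "0 < \<epsilon>"
  obtains \<delta> where "0 < \<delta>"
    "\<And>(I :: 'i set) l u. finite I \<Longrightarrow> (\<And>i. i \<in> I \<Longrightarrow> a \<le> l i \<and> l i \<le> u i \<and> u i \<le> b) \<Longrightarrow>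
       disjoint_family_on (\<lambda>i. {l i<..<u i}) I \<Longrightarrow> (\<Sum>i\<in>I. u i - l i) < \<delta> \<Longrightarrow>
       (\<Sum>i\<in>I. norm (x (u i) - x (l i))) < \<epsilon>"
proof -
  obtain \<delta> where "0 < \<delta>" and \<delta>: "\<And>(I :: nat set) l u.
        finite I \<Longrightarrow> (\<forall>i\<in>I. a \<le> l i \<and> l i \<le> u i \<and> u i \<le> b) \<Longrightarrow>
        disjoint_family_on (\<lambda>i. {l i<..<u i}) I \<Longrightarrow> (\<Sum>i\<in>I. u i - l i) < \<delta>
        \<Longrightarrow> (\<Sum>i\<in>I. norm (x (u i) - x (l i))) < \<epsilon>"
    using assms unfolding absolutely_continuous_fun_def by meson
  show thesis
  proof
    fix I :: "'i set" and l u
    assume I: "finite I" "\<And>i. i \<in> I \<Longrightarrow> a \<le> l i \<and> l i \<le> u i \<and> u i \<le> b"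
      "disjoint_family_on (\<lambda>i. {l i<..<u i}) I" "(\<Sum>i\<in>I. u i - l i) < \<delta>"
    obtain e where e: "bij_betw e {0..<card I} I"
      using ex_bij_betw_nat_finite[OF I(1)] by blast
    have eI: "e n \<in> I" if "n < card I" for n
      using e that by (auto simp: bij_betw_def)
    have disj: "disjoint_family_on (\<lambda>n. {l (e n)<..<u (e n)}) {0..<card I}"
      unfolding disjoint_family_on_def
    proof (intro ballI impI)
      fix m n assume mn: "m \<in> {0..<card I}" "n \<in> {0..<card I}" "m \<noteq> n"
      then have "e m \<noteq> e n"
        using e unfolding bij_betw_def inj_on_def by blast
      then show "{l (e m)<..<u (e m)} \<inter> {l (e n)<..<u (e n)} = {}"
        using disjoint_family_onD[OF I(3) eI eI] mn by (metis atLeastLessThan_iff)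
    qed
    have "(\<Sum>n\<in>{0..<card I}. norm (x (u (e n)) - x (l (e n)))) < \<epsilon>"
    proof (rule \<delta>[OF _ _ disj])
      show "(\<Sum>n\<in>{0..<card I}. u (e n) - l (e n)) < \<delta>"
        using I(4) sum.reindex_bij_betw[OF e, of "\<lambda>i. u i - l i"] by simp
    qed (use I(2) eI in auto)
    then show "(\<Sum>i\<in>I. norm (x (u i) - x (l i))) < \<epsilon>"
      using sum.reindex_bij_betw[OF e, of "\<lambda>i. norm (x (u i) - x (l i))"] by simp
  qed (use \<open>0 < \<delta>\<close> in auto)
qed

text \<open>
  The gauge integral makes a direct proof possible. At a point of differentiability the gauge
  is a ball on which the increment of \<open>x\<close> is close to its linear approximation; at a tag in the
  null set it is an open neighbourhood of the null set of measure below the $\delta$ of absolute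
  continuity. The intervals of the second kind then contribute increments of \<open>x\<close> of small
  total size, and the integrand may be taken to be zero at their tags.
\<close>

theorem absolutely_continuous_has_integral_derivative:
  fixes x :: "real \<Rightarrow> 'a::banach"
  assumes ac: "absolutely_continuous_fun a b x" and "a \<le> b" and neg: "negligible S"
    and der: "\<And>s. s \<in> {a..b} - S \<Longrightarrow> (x has_vector_derivative F s) (at s within {a..b})"
  shows "(F has_integral (x b - x a)) {a..b}"
proof (rule has_integral_spike[OF neg])
  let ?F = "\<lambda>s. if s \<in> S then 0 else F s"
  show "F s = ?F s" if "s \<in> {a..b} - S" for s using that by simp
  show "(?F has_integral (x b - x a)) {a..b}"
    unfolding has_integral_real
  proof (intro allI impI)
    fix e :: real assume "e > 0"
    \<comment> \<open>The summand 1 makes the division safe when the interval is a point.\<close>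
    define c where "c = e / (2 * (b - a + 1))"
    have "c > 0" using \<open>e > 0\<close> \<open>a \<le> b\<close> by (simp add: c_def)
    have "\<forall>s. \<exists>d>0. s \<in> {a..b} - S \<longrightarrow>
         (\<forall>y\<in>{a..b}. norm (y - s) < d \<longrightarrow> norm (x y - x s - (y - s) *\<^sub>R F s) \<le> c * norm (y - s))"
      using der \<open>c > 0\<close> unfolding has_vector_derivative_def has_derivative_within_alt by (meson zero_less_one)
    then obtain d where d: "\<And>s. 0 < d s"
      "\<And>s y. \<lbrakk>s \<in> {a..b} - S; y \<in> {a..b}; norm (y - s) < d s\<rbrakk> \<Longrightarrow>
           norm (x y - x s - (y - s) *\<^sub>R F s) \<le> c * norm (y - s)"
      by metis
    obtain \<delta> where "0 < \<delta>" and \<delta>: "\<And>(I :: (real \<times> real set) set) l u.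
       finite I \<Longrightarrow> (\<And>i. i \<in> I \<Longrightarrow> a \<le> l i \<and> l i \<le> u i \<and> u i \<le> b) \<Longrightarrow>
       disjoint_family_on (\<lambda>i. {l i<..<u i}) I \<Longrightarrow> (\<Sum>i\<in>I. u i - l i) < \<delta> \<Longrightarrow>
       (\<Sum>i\<in>I. norm (x (u i) - x (l i))) < e / 2"
      by (rule absolutely_continuous_fun_finite_familyE[OF ac half_gt_zero[OF \<open>e > 0\<close>]]) blast
    have S: "S \<in> null_sets lebesgue" using neg negligible_iff_null_sets by blast
    then obtain U where U: "open U" "S \<subseteq> U" "U - S \<in> lmeasurable" "emeasure lebesgue (U - S) < ennreal \<delta>"
      using sets_lebesgue_outer_open[of S \<delta>] \<open>0 < \<delta>\<close> by auto
    have Um: "U \<in> lmeasurable" "measure lebesgue U < \<delta>"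
    proof -
      have "U = (U - S) \<union> S" using U by auto
      then show "U \<in> lmeasurable"
        by (metis U(3) fmeasurable.Un neg negligible_imp_measurable)
      have "emeasure lebesgue (U - S) = emeasure lebesgue U"
        using S by (simp add: U(1) borel_open emeasure_Diff_null_set)
      then have "emeasure lebesgue U < ennreal \<delta>" using U(4) by simp
      then show "measure lebesgue U < \<delta>"
        using \<open>U \<in> lmeasurable\<close> \<open>0 < \<delta>\<close>
        by (simp add: emeasure_eq_measure2 ennreal_less_iff)
    qed
    define \<gamma> where "\<gamma> = (\<lambda>s. if s \<in> S then U else ball s (d s))"
    show "\<exists>\<gamma>. gauge \<gamma> \<and> (\<forall>p. p tagged_division_of {a..b} \<and> \<gamma> fine p \<longrightarrow>
            norm ((\<Sum>(s, K)\<in>p. measure lborel K *\<^sub>R ?F s) - (x b - x a)) < e)"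
    proof (intro exI conjI allI impI; (elim conjE)?)
      show "gauge \<gamma>"
        using U d by (auto simp: \<gamma>_def gauge_def)
      fix p assume p: "p tagged_division_of {a..b}" and fine: "\<gamma> fine p"
      have fin: "finite p" using p by blast
      have K: "K = {Inf K..Sup K} \<and> a \<le> Inf K \<and> Inf K \<le> s \<and> s \<le> Sup K \<and> Sup K \<le> b"
        if "(s, K) \<in> p" for s K
      proof -
        have *: "s \<in> K" "K \<subseteq> {a..b}" "\<exists>u v. K = cbox u v"
          using tagged_division_ofD(2,3,4)[OF p that] by blast+
        then obtain u v where "K = {u..v}" by auto
        then show ?thesis using * by auto
      qed
      define q where "q = {z \<in> p. fst z \<in> S}"
      let ?D = "\<lambda>(s, K). measure lborel K *\<^sub>R ?F s - (x (Sup K) - x (Inf K))"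
      have "(\<Sum>(s, K)\<in>p. measure lborel K *\<^sub>R ?F s) - (x b - x a) = (\<Sum>z\<in>p. ?D z)"
        using additive_tagged_division_1[OF \<open>a \<le> b\<close> p, of x]
        by (simp add: sum_subtractf case_prod_unfold)
      moreover have "(\<Sum>z\<in>p. ?D z) = (\<Sum>z\<in>p - q. ?D z) + (\<Sum>z\<in>q. ?D z)"
        by (rule sum.subset_diff) (use fin in \<open>auto simp: q_def\<close>)
      ultimately have split: "norm ((\<Sum>(s, K)\<in>p. measure lborel K *\<^sub>R ?F s) - (x b - x a))
          \<le> norm (\<Sum>z\<in>p - q. ?D z) + norm (\<Sum>z\<in>q. ?D z)"
        by (simp only: norm_triangle_ineq)
      have "norm (\<Sum>z\<in>p - q. ?D z) \<le> (\<Sum>(s, K)\<in>p - q. c * (Sup K - Inf K))"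
      proof (rule sum_norm_le, clarify)
        fix s K assume z: "(s, K) \<in> p" "(s, K) \<notin> q"
        then have "s \<notin> S" by (auto simp: q_def)
        define u v where "u = Inf K" and "v = Sup K"
        have uv: "K = {u..v}" "a \<le> u" "u \<le> s" "s \<le> v" "v \<le> b"
          using K[OF z(1)] by (auto simp: u_def v_def)
        have "K \<subseteq> ball s (d s)"
          using fineD[OF fine z(1)] \<open>s \<notin> S\<close> by (simp add: \<gamma>_def)
        moreover have "u \<in> K" "v \<in> K" using uv by auto
        ultimately have near: "norm (u - s) < d s" "norm (v - s) < d s"
          by (auto simp: dist_norm norm_minus_commute subset_iff dest!: bspec)
        have s: "s \<in> {a..b} - S" using uv \<open>s \<notin> S\<close> by auto
        have "norm ((v - u) *\<^sub>R F s - (x v - x u)) =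
            norm ((x u - x s - (u - s) *\<^sub>R F s) - (x v - x s - (v - s) *\<^sub>R F s))"
          by (simp add: algebra_simps)
        also have "\<dots> \<le> norm (x u - x s - (u - s) *\<^sub>R F s) + norm (x v - x s - (v - s) *\<^sub>R F s)"
          by (rule norm_triangle_ineq4)
        also have "\<dots> \<le> c * norm (u - s) + c * norm (v - s)"
          using d(2)[OF s _ near(1)] d(2)[OF s _ near(2)] uv by (intro add_mono) auto
        also have "\<dots> = c * (v - u)" using uv by (simp add: algebra_simps)
        finally show "norm (measure lborel K *\<^sub>R ?F s - (x (Sup K) - x (Inf K))) \<le> c * (Sup K - Inf K)"
          using \<open>s \<notin> S\<close> uv by (simp add: u_def[symmetric] v_def[symmetric])
      qed
      also have "\<dots> \<le> (\<Sum>(s, K)\<in>p. c * (Sup K - Inf K))"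
        by (rule sum_mono2[OF fin]) (use K \<open>c > 0\<close> in force)+
      also have "\<dots> = c * (b - a)"
        using additive_tagged_division_1[OF \<open>a \<le> b\<close> p, of "\<lambda>s. s"]
        by (simp add: sum_distrib_left[symmetric] case_prod_unfold)
      also have "\<dots> < e / 2"
        using \<open>e > 0\<close> \<open>a \<le> b\<close> by (simp add: c_def field_simps)
      finally have regular: "norm (\<Sum>z\<in>p - q. ?D z) < e / 2" .
      have "norm (\<Sum>z\<in>q. ?D z) \<le> (\<Sum>z\<in>q. norm (x (Sup (snd z)) - x (Inf (snd z))))"
        by (rule sum_norm_le) (auto simp: q_def norm_minus_commute)
      also have "\<dots> < e / 2"
      proof (rule \<delta>)
        have qU: "K \<subseteq> U" if "(s, K) \<in> q" for s K
          using fineD[OF fine, of s K] that by (auto simp: \<gamma>_def q_def)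
        have "q \<subseteq> p" by (auto simp: q_def)
        note * = sum_length_tagged_division_le_measure[OF p this Um(1)]
        show "disjoint_family_on (\<lambda>z. {Inf (snd z)<..<Sup (snd z)}) q"
          using *(1) qU by (simp add: case_prod_unfold)
        show "(\<Sum>z\<in>q. Sup (snd z) - Inf (snd z)) < \<delta>"
          using *(2) qU Um(2) unfolding case_prod_unfold by (meson le_less_trans)
        show "a \<le> Inf (snd z) \<and> Inf (snd z) \<le> Sup (snd z) \<and> Sup (snd z) \<le> b" if "z \<in> q" for z
          using K[of "fst z" "snd z"] that by (auto simp: q_def)
      qed (use fin in \<open>auto simp: q_def\<close>)
      finally have "norm (\<Sum>z\<in>q. ?D z) < e / 2" .
      with split regular show "norm ((\<Sum>(s, K)\<in>p. measure lborel K *\<^sub>R ?F s) - (x b - x a)) < e" by linarith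
    qed
  qed
qed

section \<open>The logarithmic norm and one-sided Lipschitz estimates\<close>

lemma infnorm_le_iff_components:
  fixes d :: "real ^ 'n"
  shows "infnorm d \<le> c \<longleftrightarrow> (\<forall>j. \<bar>d $ j\<bar> \<le> c)"
proof
  have "{\<bar>d $ i\<bar> |i. i \<in> UNIV} = range (\<lambda>i. \<bar>d $ i\<bar>)" by auto
  then show "\<forall>j. \<bar>d $ j\<bar> \<le> c \<Longrightarrow> infnorm d \<le> c"
    unfolding infnorm_cart by (auto intro: cSUP_least)
qed (meson component_le_infnorm_cart order_trans)

lemma infnorm_attained:
  fixes d :: "real ^ 'n"
  obtains j where "infnorm d = \<bar>d $ j\<bar>"
proof -
  have "{\<bar>d $ i\<bar> |i. i \<in> UNIV} = range (\<lambda>i. \<bar>d $ i\<bar>)" by auto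
  moreover have "Sup (range (\<lambda>i. \<bar>d $ i\<bar>)) \<in> range (\<lambda>i. \<bar>d $ i\<bar>)"
    using Max_in[of "range (\<lambda>i. \<bar>d $ i\<bar>)"] cSup_eq_Max[of "range (\<lambda>i. \<bar>d $ i\<bar>)"] by auto
  ultimately show thesis
    using that by (auto simp: infnorm_cart)
qed

lemma infnorm_matrix_vector_le:
  fixes Q :: "real ^ 'n ^ 'n"
  shows "infnorm (Q *v d) \<le> mat_infnorm Q * infnorm d"
proof (cases "d = 0")
  case False
  obtain C where C: "\<And>u. norm (Q *v u) \<le> norm u * C" "C \<ge> 0"
    using bounded_linear.nonneg_bounded[OF matrix_vector_mul_bounded_linear[of Q]] by auto
  have "infnorm (Q *v u) / infnorm u \<le> sqrt DIM(real ^ 'n) * C" for u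
  proof (cases "u = 0")
    case False
    have "infnorm (Q *v u) \<le> norm u * C"
      using C infnorm_le_norm order_trans by blast
    also have "\<dots> \<le> (sqrt DIM(real ^ 'n) * infnorm u) * C"
      by (intro mult_right_mono norm_le_infnorm C)
    finally show ?thesis
      using False infnorm_pos_lt[of u] by (simp add: field_simps)
  qed (use C in \<open>simp add: infnorm_0\<close>)
  then have "bdd_above (range (\<lambda>u. infnorm (Q *v u) / infnorm u))"
    by (intro bdd_aboveI2)
  then have "infnorm (Q *v d) / infnorm d \<le> mat_infnorm Q"
    unfolding mat_infnorm_def by (rule cSUP_upper2) auto
  then show ?thesis
    using False infnorm_pos_lt[of d] by (simp add: field_simps)
qed (simp add: infnorm_0)

lemma mat_infnorm_leI:
  fixes Q :: "real ^ 'n ^ 'n"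
  assumes "\<And>d. infnorm (Q *v d) \<le> C * infnorm d" "0 \<le> C"
  shows "mat_infnorm Q \<le> C"
  unfolding mat_infnorm_def
proof (rule cSUP_least)
  fix d :: "real ^ 'n"
  show "infnorm (Q *v d) / infnorm d \<le> C"
    using assms infnorm_pos_lt[of d]
    by (cases "d = 0") (simp_all add: infnorm_0 pos_divide_le_eq)
qed simp

lemma mat_infnorm_nonneg: "0 \<le> mat_infnorm (Q :: real ^ 'n ^ 'n)"
proof -
  have "0 \<le> infnorm (Q *v 1)" by (rule infnorm_pos_le)
  also have "\<dots> \<le> mat_infnorm Q * infnorm (1 :: real ^ 'n)" by (rule infnorm_matrix_vector_le)
  finally show ?thesis
    using infnorm_pos_lt[of "1 :: real ^ 'n"] by (simp add: zero_le_mult_iff)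
qed

text \<open>
  The link between the logarithmic norm and the growth of a vector: $d + h\,Qd$ has norm at
  most $\|I + hQ\|\,\|d\|$, and its coordinate \<open>j\<close>, which for $h = 0$ already has the maximal
  absolute value $\|d\|$, obeys the same bound.
\<close>

lemma component_le_mat_infnorm_quotient:
  fixes Q :: "real ^ 'n ^ 'n"
  assumes "0 < h" and "infnorm d = \<bar>d $ j\<bar>"
  shows "sgn (d $ j) * (Q *v d) $ j \<le> (mat_infnorm (mat 1 + h *\<^sub>R Q) - 1) / h * infnorm d"
proof -
  have "infnorm d + h * (sgn (d $ j) * (Q *v d) $ j) = sgn (d $ j) * ((mat 1 + h *\<^sub>R Q) *v d) $ j"
    using assms by (simp add: matrix_vector_mult_add_rdistrib scaleR_matrix_vector_assoc[symmetric]
        algebra_simps abs_sgn)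
  also have "\<dots> \<le> \<bar>((mat 1 + h *\<^sub>R Q) *v d) $ j\<bar>"
    by (auto simp: sgn_if)
  also have "\<dots> \<le> mat_infnorm (mat 1 + h *\<^sub>R Q) * infnorm d"
    using component_le_infnorm_cart infnorm_matrix_vector_le order_trans by blast
  finally show ?thesis using \<open>0 < h\<close> by (simp add: field_simps)
qed

text \<open>
  Since $I + hQ$ is a convex combination of $I$ and $I + h'Q$, the difference quotient inherits
  monotonicity from the convexity of the norm. Together with a lower bound this is why the limit
  defining the logarithmic norm exists.
\<close>

lemma mat_infnorm_quotient_mono:
  fixes Q :: "real ^ 'n ^ 'n"
  assumes "0 < h" "h \<le> h'"
  shows "(mat_infnorm (mat 1 + h *\<^sub>R Q) - 1) / h \<le> (mat_infnorm (mat 1 + h' *\<^sub>R Q) - 1) / h'"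
proof -
  let ?M = "mat_infnorm (mat 1 + h' *\<^sub>R Q)"
  define \<theta> where "\<theta> = h / h'"
  have \<theta>: "0 < \<theta>" "\<theta> \<le> 1" "h = \<theta> * h'" using assms by (auto simp: \<theta>_def)
  have "mat_infnorm (mat 1 + h *\<^sub>R Q) \<le> (1 - \<theta>) + \<theta> * ?M"
  proof (rule mat_infnorm_leI)
    fix d :: "real ^ 'n"
    have "(mat 1 + h *\<^sub>R Q) *v d = (1 - \<theta>) *\<^sub>R d + \<theta> *\<^sub>R ((mat 1 + h' *\<^sub>R Q) *v d)"
      by (simp add: matrix_vector_mult_add_rdistrib scaleR_matrix_vector_assoc[symmetric] \<theta>(3)
          algebra_simps)
    also have "infnorm \<dots> \<le> infnorm ((1 - \<theta>) *\<^sub>R d) + infnorm (\<theta> *\<^sub>R ((mat 1 + h' *\<^sub>R Q) *v d))"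
      by (rule infnorm_triangle)
    also have "\<dots> = (1 - \<theta>) * infnorm d + \<theta> * infnorm ((mat 1 + h' *\<^sub>R Q) *v d)"
      using \<theta> by (simp add: infnorm_mul)
    also have "\<dots> \<le> (1 - \<theta>) * infnorm d + \<theta> * (?M * infnorm d)"
      using \<theta> infnorm_matrix_vector_le[of "mat 1 + h' *\<^sub>R Q" d] by (simp add: mult_left_mono)
    finally show "infnorm ((mat 1 + h *\<^sub>R Q) *v d) \<le> ((1 - \<theta>) + \<theta> * ?M) * infnorm d"
      by (simp add: algebra_simps)
  qed (use \<theta> mat_infnorm_nonneg[of "mat 1 + h' *\<^sub>R Q"] in simp)
  then have "(mat_infnorm (mat 1 + h *\<^sub>R Q) - 1) / h \<le> (\<theta> * (?M - 1)) / h"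
    using assms by (intro divide_right_mono) (auto simp: algebra_simps)
  also have "\<dots> = (?M - 1) / h'" using \<theta> by simp
  finally show ?thesis .
qed

text \<open>
  A limit operator is a definite description, so nothing can be read off the
  definition of the logarithmic norm until convergence is known. The quotients decrease as
  $h \to 0^+$ and are bounded below by any diagonal entry of \<open>Q\<close>, as the preceding estimate
  shows for a unit vector; hence they converge to their infimum.
\<close>

lemma log_norm_tendsto:
  fixes Q :: "real ^ 'n ^ 'n"
  shows "((\<lambda>h. (mat_infnorm (mat 1 + h *\<^sub>R Q) - 1) / h) \<longlongrightarrow> log_norm Q) (at_right 0)"
proof -
  let ?q = "\<lambda>h. (mat_infnorm (mat 1 + h *\<^sub>R Q) - 1) / h"
  obtain j :: 'n where True by simp
  have inf: "infnorm (axis j 1 :: real ^ 'n) = \<bar>axis j 1 $ j\<bar>"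
    using component_le_infnorm_cart[of "axis j 1 :: real ^ 'n" j]
    by (intro antisym) (auto simp: infnorm_le_iff_components axis_def)
  then have low: "(Q *v axis j 1) $ j \<le> ?q h" if "0 < h" for h
    using component_le_mat_infnorm_quotient[OF that inf, of Q] inf by simp
  then have bdd: "bdd_below (?q ` {0<..})"
    by (intro bdd_belowI2[where m = "(Q *v axis j 1) $ j"]) simp
  have "(?q \<longlongrightarrow> Inf (?q ` {0<..})) (at_right 0)"
  proof (rule order_tendstoI)
    fix c assume "c < Inf (?q ` {0<..})"
    then have "c < ?q h" if "0 < h" for h
      using cINF_lower[OF bdd, of h] that by auto
    then show "eventually (\<lambda>h. c < ?q h) (at_right 0)"
      by (intro eventually_mono[OF eventually_at_right_less[of 0]])
  next
    fix c assume "Inf (?q ` {0<..}) < c"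
    then obtain h' where h': "0 < h'" "?q h' < c"
      using cINF_less_iff[OF _ bdd, of c] by auto
    then have "?q h < c" if "0 < h" "h < h'" for h
      using mat_infnorm_quotient_mono[of h h' Q] that by simp
    then show "eventually (\<lambda>h. ?q h < c) (at_right 0)"
      using h' by (auto simp: eventually_at_right_field)
  qed
  then show ?thesis
    unfolding log_norm_def by (simp add: tendsto_Lim)
qed

lemma component_le_log_norm:
  fixes Q :: "real ^ 'n ^ 'n"
  assumes "infnorm d = \<bar>d $ j\<bar>"
  shows "sgn (d $ j) * (Q *v d) $ j \<le> log_norm Q * infnorm d"
proof (rule tendsto_lowerbound)
  show "((\<lambda>h. (mat_infnorm (mat 1 + h *\<^sub>R Q) - 1) / h * infnorm d) \<longlongrightarrow> log_norm Q * infnorm d) (at_right 0)"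
    by (intro tendsto_intros log_norm_tendsto)
  show "\<forall>\<^sub>F h in at_right 0. sgn (d $ j) * (Q *v d) $ j \<le> (mat_infnorm (mat 1 + h *\<^sub>R Q) - 1) / h * infnorm d"
    using component_le_mat_infnorm_quotient[OF _ assms, of _ Q]
    by (intro eventually_mono[OF eventually_at_right_less[of 0]])
qed simp

text \<open>
  The mean value theorem fails for vector-valued functions, but every estimate below is
  made coordinate by coordinate, where it holds on the segment between the two points.
\<close>

lemma component_mean_value:
  fixes F :: "real ^ 'n \<Rightarrow> real ^ 'n"
  assumes F: "\<And>z. F differentiable (at z)" and "convex B" "\<xi> \<in> B" "\<eta> \<in> B"
  obtains z where "z \<in> B" "F \<xi> $ j - F \<eta> $ j = (jacobian F (at z) *v (\<xi> - \<eta>)) $ j"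
proof -
  define \<gamma> where "\<gamma> = (\<lambda>\<theta>::real. \<eta> + \<theta> *\<^sub>R (\<xi> - \<eta>))"
  have in_B: "\<gamma> \<theta> \<in> B" if "0 \<le> \<theta>" "\<theta> \<le> 1" for \<theta>
  proof -
    have "\<gamma> \<theta> = (1 - \<theta>) *\<^sub>R \<eta> + \<theta> *\<^sub>R \<xi>" by (simp add: \<gamma>_def algebra_simps)
    then show ?thesis using convexD[OF \<open>convex B\<close> assms(4,3), of "1 - \<theta>" \<theta>] that by simp
  qed
  have "((\<lambda>\<theta>. F (\<gamma> \<theta>) $ j) has_derivative (\<lambda>u. (jacobian F (at (\<gamma> \<theta>)) *v (u *\<^sub>R (\<xi> - \<eta>))) $ j))
      (at \<theta> within {0..1})" for \<theta>
  proof -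
    have "(F has_derivative (\<lambda>h. jacobian F (at (\<gamma> \<theta>)) *v h)) (at (\<gamma> \<theta>))"
      using F jacobian_works by blast
    moreover have "(\<gamma> has_derivative (\<lambda>u. u *\<^sub>R (\<xi> - \<eta>))) (at \<theta> within {0..1})"
      unfolding \<gamma>_def by (auto intro!: derivative_eq_intros)
    ultimately have "((\<lambda>\<theta>. F (\<gamma> \<theta>)) has_derivative (\<lambda>u. jacobian F (at (\<gamma> \<theta>)) *v (u *\<^sub>R (\<xi> - \<eta>))))
      (at \<theta> within {0..1})"
      by (rule has_derivative_compose[rotated])
    then show ?thesis
      by (rule bounded_linear.has_derivative[OF bounded_linear_vec_nth])
  qed
  then have "\<exists>\<theta>\<in>{0..1}. F (\<gamma> 1) $ j - F (\<gamma> 0) $ j = (jacobian F (at (\<gamma> \<theta>)) *v ((1 - 0) *\<^sub>R (\<xi> - \<eta>))) $ j"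
    by (intro mvt_very_simple[where f = "\<lambda>\<theta>. F (\<gamma> \<theta>) $ j"]) auto
  then obtain \<theta> where "\<theta> \<in> {0..1}"
    "F (\<gamma> 1) $ j - F (\<gamma> 0) $ j = (jacobian F (at (\<gamma> \<theta>)) *v ((1 - 0) *\<^sub>R (\<xi> - \<eta>))) $ j" ..
  then show thesis
    using that in_B by (auto simp: \<gamma>_def)
qed

lemma infnorm_diff_le_Lipschitz:
  fixes F :: "real ^ 'n \<Rightarrow> real ^ 'n"
  assumes "\<And>z. F differentiable (at z)" "convex B" "\<xi> \<in> B" "\<eta> \<in> B"
    and L: "\<And>z. z \<in> B \<Longrightarrow> mat_infnorm (jacobian F (at z)) \<le> L"
  shows "infnorm (F \<xi> - F \<eta>) \<le> L * infnorm (\<xi> - \<eta>)"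
  unfolding infnorm_le_iff_components
proof
  fix j
  obtain z where "z \<in> B" "F \<xi> $ j - F \<eta> $ j = (jacobian F (at z) *v (\<xi> - \<eta>)) $ j"
    using component_mean_value[OF assms(1-4)] .
  then have "\<bar>(F \<xi> - F \<eta>) $ j\<bar> \<le> infnorm (jacobian F (at z) *v (\<xi> - \<eta>))"
    by (simp add: component_le_infnorm_cart)
  also have "\<dots> \<le> mat_infnorm (jacobian F (at z)) * infnorm (\<xi> - \<eta>)"
    by (rule infnorm_matrix_vector_le)
  also have "\<dots> \<le> L * infnorm (\<xi> - \<eta>)"
    by (intro mult_right_mono L \<open>z \<in> B\<close> infnorm_pos_le)
  finally show "\<bar>(F \<xi> - F \<eta>) $ j\<bar> \<le> L * infnorm (\<xi> - \<eta>)" .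
qed

text \<open>
  The one-sided counterpart of the Lipschitz estimate: it controls only the outward motion in a
  maximal coordinate, and in exchange the constant $\Lambda$ may be much smaller than the Lipschitz
  constant, even negative.
\<close>

lemma component_diff_le_one_sided_Lipschitz:
  fixes F :: "real ^ 'n \<Rightarrow> real ^ 'n"
  assumes "\<And>z. F differentiable (at z)" "convex B" "\<xi> \<in> B" "\<eta> \<in> B"
    and \<Lambda>: "\<And>z. z \<in> B \<Longrightarrow> log_norm (jacobian F (at z)) \<le> \<Lambda>"
    and j: "infnorm (\<xi> - \<eta>) = \<bar>(\<xi> - \<eta>) $ j\<bar>"
  shows "sgn ((\<xi> - \<eta>) $ j) * (F \<xi> $ j - F \<eta> $ j) \<le> \<Lambda> * infnorm (\<xi> - \<eta>)"
proof -
  obtain z where "z \<in> B" and z: "F \<xi> $ j - F \<eta> $ j = (jacobian F (at z) *v (\<xi> - \<eta>)) $ j"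
    using component_mean_value[OF assms(1-4)] .
  have "sgn ((\<xi> - \<eta>) $ j) * (F \<xi> $ j - F \<eta> $ j) \<le> log_norm (jacobian F (at z)) * infnorm (\<xi> - \<eta>)"
    using component_le_log_norm[OF j] z by simp
  also have "\<dots> \<le> \<Lambda> * infnorm (\<xi> - \<eta>)"
    by (intro mult_right_mono \<Lambda> \<open>z \<in> B\<close> infnorm_pos_le)
  finally show ?thesis .
qed

section \<open>A differential inequality for the supremum norm\<close>

text \<open>
  The solution of $\mu' = \Lambda\mu + 1$ with $\mu(0) = 0$.
\<close>

definition growth :: "real \<Rightarrow> real \<Rightarrow> real" where
  "growth \<Lambda> s = s * phi (\<Lambda> * s)"

lemma growth_0 [simp]: "growth \<Lambda> 0 = 0"
  by (simp add: growth_def)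

lemma growth_closed_form: "growth \<Lambda> s = (if \<Lambda> = 0 then s else (exp (\<Lambda> * s) - 1) / \<Lambda>)"
  by (simp add: growth_def phi_def)

lemma exp_eq_growth: "exp (\<Lambda> * s) = \<Lambda> * growth \<Lambda> s + 1"
  by (simp add: growth_closed_form)

lemma growth_has_derivative: "(growth \<Lambda> has_real_derivative exp (\<Lambda> * s)) (at s within S)"
proof (cases "\<Lambda> = 0")
  case True
  then have "growth \<Lambda> = (\<lambda>s. s)" by (auto simp: growth_closed_form)
  then show ?thesis using True by simp
next
  case False
  then have "growth \<Lambda> = (\<lambda>s. (exp (\<Lambda> * s) - 1) / \<Lambda>)" by (auto simp: growth_closed_form)
  then show ?thesis using False by (auto intro!: derivative_eq_intros)
qed

lemma growth_mono: "s \<le> s' \<Longrightarrow> growth \<Lambda> s \<le> growth \<Lambda> s'"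
proof (erule DERIV_nonneg_imp_nondecreasing)
  fix r
  show "\<exists>y. (growth \<Lambda> has_real_derivative y) (at r) \<and> 0 \<le> y"
    using growth_has_derivative[of \<Lambda> r UNIV] exp_ge_zero by blast
qed

lemma growth_nonneg: "0 \<le> s \<Longrightarrow> 0 \<le> growth \<Lambda> s"
  using growth_mono[of 0 s \<Lambda>] by simp

text \<open>
  A crossing argument replaces differentiating the norm of \<open>z\<close>, which need not be
  differentiable. At the first time \<open>r\<close> at which the norm reaches \<open>\<mu>\<close>, some coordinate has
  absolute value \<open>\<mu> r\<close>. Just before \<open>r\<close> that coordinate climbs more slowly than \<open>\<mu>\<close>, because the
  derivative of \<open>\<mu>\<close> exceeds the admissible speed by \<open>\<epsilon>\<close>. So it lay above \<open>\<mu>\<close> earlier,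
  contradicting the choice of \<open>r\<close>.
\<close>

lemma infnorm_le_strict_supersolution:
  fixes z \<phi> :: "real \<Rightarrow> real ^ 'n" and \<mu> :: "real \<Rightarrow> real"
  assumes z: "continuous_on {a..b} z" "z a = 0" and \<phi>: "continuous_on {a..b} \<phi>"
    and incr: "\<And>c d j. a \<le> c \<Longrightarrow> c \<le> d \<Longrightarrow> d \<le> b \<Longrightarrow>
        \<bar>(z d - z c) $ j - integral {c..d} (\<lambda>s. \<phi> s $ j)\<bar> \<le> R * (d - c)"
    and one_sided: "\<And>s j. s \<in> {a..b} \<Longrightarrow> infnorm (z s) = \<bar>z s $ j\<bar> \<Longrightarrow>
        sgn (z s $ j) * \<phi> s $ j \<le> \<Lambda> * infnorm (z s)"
    and \<mu>: "\<And>s. s \<in> {a..b} \<Longrightarrow> (\<mu> has_real_derivative (\<Lambda> * \<mu> s + R + \<epsilon>)) (at s within {a..b})"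
    and pos: "\<And>s. s \<in> {a..b} \<Longrightarrow> 0 < \<mu> s" and "0 < \<epsilon>" and s: "s \<in> {a..b}"
  shows "infnorm (z s) \<le> \<mu> s"
proof (rule ccontr)
  let ?u = "\<lambda>s. infnorm (z s)"
  assume "\<not> ?u s \<le> \<mu> s"
  have c\<mu>: "continuous_on {a..b} \<mu>"
    by (rule DERIV_continuous_on) (rule \<mu>)
  have cont: "continuous_on {a..b} (\<lambda>s. ?u s - \<mu> s)"
    by (intro continuous_intros z c\<mu>)
  define A where "A = {a..b} \<inter> (\<lambda>s. ?u s - \<mu> s) -` {0..}"
  define r where "r = Inf A"
  have "s \<in> A" using \<open>\<not> ?u s \<le> \<mu> s\<close> s by (simp add: A_def)
  moreover have "closed A"
    unfolding A_def using cont by (intro continuous_closed_preimage) auto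
  moreover have bdd: "bdd_below A" by (auto simp: A_def)
  ultimately have "r \<in> A" unfolding r_def by (intro closed_contains_Inf) auto
  then have r: "r \<in> {a..b}" "\<mu> r \<le> ?u r" by (auto simp: A_def)
  have below: "?u c < \<mu> c" if "a \<le> c" "c < r" for c
  proof (rule ccontr)
    assume "\<not> ?u c < \<mu> c"
    then have "c \<in> A" using that r by (simp add: A_def)
    then have "r \<le> c" unfolding r_def using bdd by (rule cInf_lower)
    then show False using that by simp
  qed
  have "a \<noteq> r" using r pos[of a] \<open>z a = 0\<close> by (auto simp: infnorm_0)
  then have "a < r" using r by auto
  have eq: "?u r = \<mu> r"
  proof -
    have "?u a - \<mu> a \<le> 0" using r pos[of a] \<open>z a = 0\<close> by (simp add: infnorm_0)
    moreover have "0 \<le> ?u r - \<mu> r" using r by simp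
    moreover have "continuous_on {a..r} (\<lambda>s. ?u s - \<mu> s)"
      by (rule continuous_on_subset[OF cont]) (use r in auto)
    ultimately obtain c where c: "a \<le> c" "c \<le> r" "?u c - \<mu> c = 0"
      using IVT'[of "\<lambda>s. ?u s - \<mu> s" a 0 r] \<open>a < r\<close> by (meson less_imp_le)
    have "\<not> c < r" using below[OF c(1)] c(3) by force
    then have "c = r" using c(2) by simp
    then show ?thesis using c(3) by simp
  qed
  obtain j where j: "?u r = \<bar>z r $ j\<bar>" by (rule infnorm_attained)
  define \<sigma> where "\<sigma> = sgn (z r $ j)"
  have \<sigma>: "\<bar>\<sigma>\<bar> = 1" "\<sigma> * z r $ j = \<mu> r"
    using j eq pos[OF r(1)] by (simp_all add: \<sigma>_def sgn_if split: if_splits)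
  have \<phi>j: "continuous_on {a..b} (\<lambda>s. \<sigma> * \<phi> s $ j)"
    by (intro continuous_intros \<phi>)
  have "0 < \<epsilon> / 3" using \<open>0 < \<epsilon>\<close> by simp
  then obtain \<delta>\<^sub>1 where "\<delta>\<^sub>1 > 0" and \<delta>\<^sub>1: "\<And>s. s \<in> {a..b} \<Longrightarrow> dist s r < \<delta>\<^sub>1 \<Longrightarrow>
      dist (\<sigma> * \<phi> s $ j) (\<sigma> * \<phi> r $ j) < \<epsilon> / 3"
    using \<phi>j[unfolded continuous_on_iff, rule_format, OF r(1) \<open>0 < \<epsilon> / 3\<close>] by blast
  obtain \<delta>\<^sub>2 where "\<delta>\<^sub>2 > 0" and \<delta>\<^sub>2: "\<And>s. s \<in> {a..b} \<Longrightarrow> norm (s - r) < \<delta>\<^sub>2 \<Longrightarrow>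
      norm (\<mu> s - \<mu> r - (\<Lambda> * \<mu> r + R + \<epsilon>) * (s - r)) \<le> \<epsilon> / 3 * norm (s - r)"
    using conjunct2[OF \<mu>[OF r(1), unfolded has_field_derivative_def has_derivative_within_alt],
        rule_format, OF \<open>0 < \<epsilon> / 3\<close>] by blast
  \<comment> \<open>Half of the smaller radius keeps the distance to the crossing time strictly inside both.\<close>
  define c where "c = max a (r - min \<delta>\<^sub>1 \<delta>\<^sub>2 / 2)"
  have c: "a \<le> c" "c < r" "r - c < \<delta>\<^sub>1" "r - c < \<delta>\<^sub>2"
    using \<open>a < r\<close> \<open>\<delta>\<^sub>1 > 0\<close> \<open>\<delta>\<^sub>2 > 0\<close> unfolding c_def by linarith+
  have int: "(\<lambda>s. \<sigma> * \<phi> s $ j) integrable_on {c..r}"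
    using c r by (intro integrable_continuous_real continuous_on_subset[OF \<phi>j]) auto
  have "integral {c..r} (\<lambda>s. \<sigma> * \<phi> s $ j) \<le> integral {c..r} (\<lambda>s. \<Lambda> * \<mu> r + \<epsilon> / 3)"
  proof (rule integral_le[OF int])
    fix s assume "s \<in> {c..r}"
    then have "dist (\<sigma> * \<phi> s $ j) (\<sigma> * \<phi> r $ j) < \<epsilon> / 3"
      using c r by (intro \<delta>\<^sub>1) (auto simp: dist_norm)
    moreover have "\<sigma> * \<phi> r $ j \<le> \<Lambda> * \<mu> r"
      using one_sided[OF r(1) j] eq by (simp add: \<sigma>_def)
    ultimately show "\<sigma> * \<phi> s $ j \<le> \<Lambda> * \<mu> r + \<epsilon> / 3"
      unfolding dist_real_def by linarith
  qed auto
  also have "\<dots> = (\<Lambda> * \<mu> r + \<epsilon> / 3) * (r - c)"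
    using c by simp
  finally have "\<sigma> * integral {c..r} (\<lambda>s. \<phi> s $ j) \<le> (\<Lambda> * \<mu> r + \<epsilon> / 3) * (r - c)"
    by simp
  moreover have "\<sigma> * ((z r - z c) $ j - integral {c..r} (\<lambda>s. \<phi> s $ j)) \<le> R * (r - c)"
  proof -
    have "\<sigma> * ((z r - z c) $ j - integral {c..r} (\<lambda>s. \<phi> s $ j))
        \<le> \<bar>(z r - z c) $ j - integral {c..r} (\<lambda>s. \<phi> s $ j)\<bar>"
      using \<sigma>(1) by (metis abs_ge_self abs_mult mult_1)
    then show ?thesis using incr[of c r j] c r by simp
  qed
  ultimately have "\<mu> r - \<sigma> * z c $ j \<le> (\<Lambda> * \<mu> r + \<epsilon> / 3 + R) * (r - c)"
    using \<sigma>(2) by (simp add: algebra_simps)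
  moreover have "\<sigma> * z c $ j < \<mu> c"
  proof -
    have "\<sigma> * z c $ j \<le> \<bar>z c $ j\<bar>"
      using \<sigma>(1) by (metis abs_ge_self abs_mult mult_1)
    also have "\<dots> \<le> ?u c" by (rule component_le_infnorm_cart)
    also have "\<dots> < \<mu> c" by (rule below) (use c in auto)
    finally show ?thesis .
  qed
  moreover have "\<mu> c - \<mu> r + (\<Lambda> * \<mu> r + R + \<epsilon>) * (r - c) \<le> \<epsilon> / 3 * (r - c)"
  proof -
    have "norm (\<mu> c - \<mu> r - (\<Lambda> * \<mu> r + R + \<epsilon>) * (c - r)) \<le> \<epsilon> / 3 * norm (c - r)"
      using c r by (intro \<delta>\<^sub>2) auto
    moreover have "norm (c - r) = r - c" using c by simp
    moreover have "(\<Lambda> * \<mu> r + R + \<epsilon>) * (c - r) = - ((\<Lambda> * \<mu> r + R + \<epsilon>) * (r - c))"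
      by (simp add: algebra_simps)
    ultimately show ?thesis by (simp only: real_norm_def abs_le_iff) linarith
  qed
  ultimately have "0 < (\<epsilon> / 3) * (r - c) + \<epsilon> / 3 * (r - c) - \<epsilon> * (r - c)"
    by (simp only: distrib_right)
  moreover have "0 < \<epsilon> * (r - c)" using c \<open>0 < \<epsilon>\<close> by simp
  ultimately show False by simp
qed

text \<open>
  The hypotheses on increments say, in integrated form, that \<open>z\<close> has velocity \<open>\<phi>\<close> up to an
  error of size \<open>R\<close>. The strict supersolutions have initial value \<open>\<epsilon>\<close> and forcing
  \<open>R + \<epsilon>\<close>; letting \<open>\<epsilon>\<close> tend to zero yields the bound.
\<close>

lemma infnorm_le_growth:
  fixes z \<phi> :: "real \<Rightarrow> real ^ 'n"
  assumes "continuous_on {a..b} z" "z a = 0" "continuous_on {a..b} \<phi>"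
    and "\<And>c d j. a \<le> c \<Longrightarrow> c \<le> d \<Longrightarrow> d \<le> b \<Longrightarrow>
        \<bar>(z d - z c) $ j - integral {c..d} (\<lambda>s. \<phi> s $ j)\<bar> \<le> R * (d - c)"
    and "\<And>s j. s \<in> {a..b} \<Longrightarrow> infnorm (z s) = \<bar>z s $ j\<bar> \<Longrightarrow>
        sgn (z s $ j) * \<phi> s $ j \<le> \<Lambda> * infnorm (z s)"
    and "0 \<le> R" and s: "s \<in> {a..b}"
  shows "infnorm (z s) \<le> R * growth \<Lambda> (s - a)"
proof (rule field_le_epsilon)
  fix e :: real assume "0 < e"
  define M where "M = exp (\<Lambda> * (s - a)) + growth \<Lambda> (s - a)"
  define \<epsilon> where "\<epsilon> = e / M"
  have "0 < M" using growth_nonneg[of "s - a" \<Lambda>] s by (auto simp: M_def intro: add_pos_nonneg)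
  then have "0 < \<epsilon>" using \<open>0 < e\<close> by (simp add: \<epsilon>_def)
  define \<mu> where "\<mu> = (\<lambda>r. \<epsilon> * exp (\<Lambda> * (r - a)) + (R + \<epsilon>) * growth \<Lambda> (r - a))"
  have "infnorm (z s) \<le> \<mu> s"
  proof (rule infnorm_le_strict_supersolution[OF assms(1-5) _ _ \<open>0 < \<epsilon>\<close> s])
    fix r assume "r \<in> {a..b}"
    have "((\<lambda>r. growth \<Lambda> (r - a)) has_real_derivative exp (\<Lambda> * (r - a)) * 1) (at r within {a..b})"
      by (rule DERIV_chain2[OF growth_has_derivative]) (auto intro!: derivative_eq_intros)
    note [derivative_intros] = this
    show "(\<mu> has_real_derivative (\<Lambda> * \<mu> r + R + \<epsilon>)) (at r within {a..b})"
      unfolding \<mu>_def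
      by (rule derivative_eq_intros refl | simp only: exp_eq_growth)+ (simp add: algebra_simps)
    show "0 < \<mu> r"
      using \<open>0 < \<epsilon>\<close> \<open>0 \<le> R\<close> \<open>r \<in> {a..b}\<close> growth_nonneg[of "r - a" \<Lambda>]
      by (auto simp: \<mu>_def intro!: add_pos_nonneg)
  qed
  also have "\<mu> s = R * growth \<Lambda> (s - a) + \<epsilon> * M"
    by (simp add: \<mu>_def M_def algebra_simps)
  also have "\<epsilon> * M = e" using \<open>0 < M\<close> by (simp add: \<epsilon>_def)
  finally show "infnorm (z s) \<le> R * growth \<Lambda> (s - a) + e" .
qed

section \<open>Integrals against an input with mean zero\<close>

lemma absolutely_integrable_bounded_measurable_times_continuous:
  fixes G v :: "real \<Rightarrow> real"
  assumes "v \<in> borel_measurable (lebesgue_on {a..b})" "\<And>s. s \<in> {a..b} \<Longrightarrow> \<bar>v s\<bar> \<le> V"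
    and "continuous_on {a..b} G"
  shows "(\<lambda>s. v s * G s) absolutely_integrable_on {a..b}"
proof -
  have "bounded (v ` {a..b})"
    using assms(2) unfolding bounded_iff by (intro exI[of _ V]) auto
  then show ?thesis
    using assms by (intro absolutely_integrable_bounded_measurable_product_real
        absolutely_integrable_continuous_real) auto
qed

lemmas integrable_bounded_measurable_times_continuous =
  set_lebesgue_integral_eq_integral(1)[OF absolutely_integrable_bounded_measurable_times_continuous]

text \<open>
  Summing over \<open>n\<close> equal pieces leaves a total of order \<open>1 / n\<close>. This turns a
  local estimate with quadratic error into a global one without any differentiation.
\<close>

lemma nonincreasing_if_increments_le_quadratic:
  fixes Q :: "real \<Rightarrow> real"
  assumes "a \<le> b" and Q: "\<And>c d. a \<le> c \<Longrightarrow> c \<le> d \<Longrightarrow> d \<le> b \<Longrightarrow> Q d - Q c \<le> M * (d - c)\<^sup>2"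
  shows "Q b \<le> Q a"
proof -
  have "Q b - Q a \<le> (M * (b - a)\<^sup>2) / real n" if "n > 0" for n
  proof -
    define p where "p = (\<lambda>i. a + real i * ((b - a) / real n))"
    have p: "a \<le> p i" "p i \<le> p (Suc i)" for i
      using \<open>a \<le> b\<close> by (auto simp: p_def intro!: mult_right_mono divide_right_mono)
    have pn: "p i \<le> b" if "i \<le> n" for i
    proof -
      have "real i * ((b - a) / real n) \<le> real n * ((b - a) / real n)"
        using that \<open>a \<le> b\<close> by (intro mult_right_mono) auto
      then show ?thesis using \<open>n > 0\<close> by (simp add: p_def)
    qed
    have "Q b - Q a = Q (p n) - Q (p 0)"
      using \<open>n > 0\<close> by (simp add: p_def)
    also have "\<dots> = (\<Sum>i<n. Q (p (Suc i)) - Q (p i))"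
      by (rule sum_lessThan_telescope[symmetric])
    also have "\<dots> \<le> (\<Sum>i<n. M * (p (Suc i) - p i)\<^sup>2)"
      by (intro sum_mono Q p pn) auto
    also have "\<dots> = (\<Sum>i<n. M * ((b - a) / real n)\<^sup>2)"
    proof (rule sum.cong)
      fix i
      have "p (Suc i) - p i = (b - a) / real n"
        by (simp add: p_def distrib_right add_divide_distrib)
      then show "M * (p (Suc i) - p i)\<^sup>2 = M * ((b - a) / real n)\<^sup>2" by simp
    qed simp
    also have "\<dots> = (M * (b - a)\<^sup>2) / real n"
      using \<open>n > 0\<close> by (simp add: power2_eq_square)
    finally show ?thesis .
  qed
  moreover have "(\<lambda>n. (M * (b - a)\<^sup>2) / real n) \<longlonglongrightarrow> 0"
    by (rule lim_const_over_n)
  ultimately have "Q b - Q a \<le> 0"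
    by (intro LIMSEQ_le_const[where X = "\<lambda>n. (M * (b - a)\<^sup>2) / real n"]) (auto intro!: exI[of _ 1])
  then show ?thesis by simp
qed

lemma abs_integral_le:
  fixes f :: "real \<Rightarrow> real"
  assumes "f integrable_on {c..d}" "c \<le> d" "\<And>s. s \<in> {c..d} \<Longrightarrow> \<bar>f s\<bar> \<le> M"
  shows "\<bar>integral {c..d} f\<bar> \<le> M * (d - c)"
proof -
  have "norm (integral {c..d} f) \<le> integral {c..d} (\<lambda>s. M)"
    using assms by (intro integral_norm_bound_integral) auto
  then show ?thesis using \<open>c \<le> d\<close> by (simp add: mult.commute)
qed

text \<open>
  Integration by parts for a factor \<open>G\<close> that is only Lipschitz and a factor \<open>u = v - w\<close>
  that is only measurable. With \<open>U\<close> the primitive of \<open>u\<close>, the function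
  $D(\tau) = \int_a^\tau u G - G(\tau)\,U(\tau)$ would formally have derivative $-G' U$. Instead,
  its increments are bounded by those of \<open>C * P\<close> up to quadratic terms, where \<open>P\<close> is the primitive
  of the parabola \<open>\<beta>\<close> dominating $|U|$. The conclusion is $|D(b)| \le C\,P(b)$, and
  $U(b) = 0$ makes \<open>D b\<close> the integral in question.
\<close>

lemma integral_Lipschitz_mult_centred:
  fixes G v :: "real \<Rightarrow> real"
  assumes "a < b" and v: "v \<in> borel_measurable (lebesgue_on {a..b})" "\<And>s. s \<in> {a..b} \<Longrightarrow> \<bar>v s\<bar> \<le> V"
    and w: "w = 1 / (b - a) * integral {a..b} v"
    and G: "\<And>r s. r \<in> {a..b} \<Longrightarrow> s \<in> {a..b} \<Longrightarrow> \<bar>G s - G r\<bar> \<le> C * \<bar>s - r\<bar>"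
  shows "\<bar>integral {a..b} (\<lambda>s. (v s - w) * G s)\<bar> \<le> C * V * (b - a)\<^sup>2 / 3"
proof -
  have "0 \<le> V" using v(2)[of a] \<open>a < b\<close> by force
  have "0 \<le> C" using G[of a b] \<open>a < b\<close> by (smt (verit) atLeastAtMost_iff zero_le_mult_iff)
  have contG: "continuous_on {a..b} G"
  proof -
    have "C-lipschitz_on {a..b} G"
      using G \<open>0 \<le> C\<close> by (auto simp: lipschitz_on_def dist_real_def abs_minus_commute)
    then show ?thesis by (rule lipschitz_on_continuous_on)
  qed
  define u where "u = (\<lambda>s. v s - w)"
  have v_int: "v integrable_on {c..d}" if "a \<le> c" "d \<le> b" for c d
    using integrable_bounded_measurable_times_continuous[OF v, of "\<lambda>_. 1"] that
    by (auto intro: integrable_on_subinterval)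
  have w_le: "\<bar>w\<bar> \<le> V"
    using abs_integral_le[OF v_int[of a b] _ v(2)] \<open>a < b\<close> by (simp add: w abs_mult field_simps)
  have u_le: "\<bar>u s\<bar> \<le> 2 * V" if "s \<in> {a..b}" for s
    using v(2)[OF that] w_le by (simp add: u_def)
  have u_meas: "u \<in> borel_measurable (lebesgue_on {a..b})"
    unfolding u_def using v(1) by simp
  have u_int: "u integrable_on {c..d}" if "a \<le> c" "d \<le> b" for c d
    using integrable_bounded_measurable_times_continuous[OF u_meas u_le, of "\<lambda>_. 1"] that
    by (auto intro: integrable_on_subinterval)
  have uG_int: "(\<lambda>s. u s * G s) integrable_on {c..d}" if "a \<le> c" "d \<le> b" for c d
    using integrable_bounded_measurable_times_continuous[OF u_meas u_le contG] that
    by (auto intro: integrable_on_subinterval)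
  define U where "U = (\<lambda>\<tau>. integral {a..\<tau>} u)"
  define \<beta> where "\<beta> = (\<lambda>\<tau>. 2 * V * (\<tau> - a) * (b - \<tau>) / (b - a))"
  define P where "P = (\<lambda>\<tau>. 2 * V * ((\<tau> - a)\<^sup>2 / 2 - (\<tau> - a)^3 / (3 * (b - a))))"
  have U_eq: "U \<tau> = integral {a..\<tau>} v - (\<tau> - a) * w" if "\<tau> \<in> {a..b}" for \<tau>
    using that integral_diff[OF v_int[of a \<tau>] integrable_const_ivl[of w a \<tau>]]
    by (simp add: U_def u_def)
  have "U b = 0" using U_eq[of b] \<open>a < b\<close> by (simp add: w)
  have U_le: "\<bar>U \<tau>\<bar> \<le> \<beta> \<tau>" if "\<tau> \<in> {a..b}" for \<tau>
  proof -
    let ?I = "integral {a..\<tau>} v" and ?J = "integral {\<tau>..b} v"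
    have IJ: "integral {a..b} v = ?I + ?J"
      using that v_int[of a b] by (simp add: Henstock_Kurzweil_Integration.integral_combine)
    have I: "\<bar>?I\<bar> \<le> V * (\<tau> - a)" "\<bar>?J\<bar> \<le> V * (b - \<tau>)"
      using that by (auto intro!: abs_integral_le v_int v(2))
    \<comment> \<open>With the mean eliminated, the two halves of the integral enter with opposite weights, and each is bounded separately.\<close>
    have "(b - a) * U \<tau> = (b - \<tau>) * ?I - (\<tau> - a) * ?J"
      using \<open>a < b\<close> by (simp add: U_eq[OF that] w IJ field_simps)
    also have "\<bar>\<dots>\<bar> \<le> \<bar>(b - \<tau>) * ?I\<bar> + \<bar>(\<tau> - a) * ?J\<bar>" by (rule abs_triangle_ineq4)
    also have "\<dots> \<le> (b - \<tau>) * (V * (\<tau> - a)) + (\<tau> - a) * (V * (b - \<tau>))"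
      using that I unfolding abs_mult by (intro add_mono mult_mono) auto
    finally show ?thesis
      using \<open>a < b\<close> by (simp add: \<beta>_def abs_mult field_simps)
  qed
  have \<beta>_P: "\<beta> c * (d - c) \<le> P d - P c + V * (d - c)\<^sup>2" if "a \<le> c" "c \<le> d" "d \<le> b" for c d
  proof -
    define p q h where "p = c - a" and "q = d - a" and "h = b - a"
    have pq: "0 \<le> p" "p \<le> q" "q \<le> h" "0 < h" using that \<open>a < b\<close> by (auto simp: p_def q_def h_def)
    \<comment> \<open>The left Riemann sum overestimates where the parabola decreases; a full square compensates for this.\<close>
    have "P d - P c + V * (d - c)\<^sup>2 - \<beta> c * (d - c)
      = 2 * V * (q\<^sup>2 / 2 - q^3 / (3 * h)) - 2 * V * (p\<^sup>2 / 2 - p^3 / (3 * h)) + V * (q - p)\<^sup>2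
          - 2 * V * p * (h - p) / h * (q - p)"
      by (simp add: P_def \<beta>_def p_def q_def h_def)
    also have "\<dots> = 2 * V * (q - p)\<^sup>2 * (1 - (q + 2 * p) / (3 * h))"
      using \<open>0 < h\<close> by (simp add: field_simps power2_eq_square power3_eq_cube)
    also have "\<dots> \<ge> 0"
      using pq \<open>0 \<le> V\<close> by (intro mult_nonneg_nonneg) (auto simp: divide_le_eq)
    finally show ?thesis by simp
  qed
  define D where "D = (\<lambda>\<tau>. integral {a..\<tau>} (\<lambda>s. u s * G s) - G \<tau> * U \<tau>)"
  have D_incr: "\<bar>D d - D c\<bar> \<le> C * (P d - P c) + 3 * V * C * (d - c)\<^sup>2" if "a \<le> c" "c \<le> d" "d \<le> b" for c d
  proof -
    have "integral {a..d} u = integral {a..c} u + integral {c..d} u"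
      "integral {a..d} (\<lambda>s. u s * G s) = integral {a..c} (\<lambda>s. u s * G s) + integral {c..d} (\<lambda>s. u s * G s)"
      using that u_int[of a d] uG_int[of a d] by (simp_all add: Henstock_Kurzweil_Integration.integral_combine)
    moreover have "integral {c..d} (\<lambda>s. u s * (G s - G d))
        = integral {c..d} (\<lambda>s. u s * G s) - integral {c..d} u * G d"
      using that u_int[of c d] uG_int[of c d] by (simp add: right_diff_distrib integral_diff integrable_on_mult_left)
    ultimately have "D d - D c = integral {c..d} (\<lambda>s. u s * (G s - G d)) - (G d - G c) * U c"
      by (simp add: D_def U_def algebra_simps)
    also have "\<bar>\<dots>\<bar> \<le> \<bar>integral {c..d} (\<lambda>s. u s * (G s - G d))\<bar> + \<bar>(G d - G c) * U c\<bar>"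
      by (rule abs_triangle_ineq4)
    also have "\<bar>integral {c..d} (\<lambda>s. u s * (G s - G d))\<bar> \<le> (2 * V * (C * (d - c))) * (d - c)"
    proof (rule abs_integral_le)
      show "(\<lambda>s. u s * (G s - G d)) integrable_on {c..d}"
        using that u_int[of c d] uG_int[of c d]
        by (auto simp: right_diff_distrib intro!: integrable_diff integrable_on_mult_left)
      fix s assume s: "s \<in> {c..d}"
      have "\<bar>G s - G d\<bar> \<le> C * \<bar>s - d\<bar>" using that s by (intro G) auto
      also have "\<dots> \<le> C * (d - c)" using s \<open>0 \<le> C\<close> by (intro mult_left_mono) auto
      finally show "\<bar>u s * (G s - G d)\<bar> \<le> 2 * V * (C * (d - c))"
        using u_le[of s] s that \<open>0 \<le> V\<close> unfolding abs_mult by (intro mult_mono) auto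
    qed (use that in auto)
    also have "\<bar>(G d - G c) * U c\<bar> \<le> C * (d - c) * \<beta> c"
      using G[of c d] U_le[of c] that \<open>0 \<le> C\<close> unfolding abs_mult by (intro mult_mono) auto
    also have "C * (d - c) * \<beta> c \<le> C * (P d - P c + V * (d - c)\<^sup>2)"
      using mult_left_mono[OF \<beta>_P[OF that] \<open>0 \<le> C\<close>] by (simp add: mult_ac)
    finally show ?thesis by (simp add: power2_eq_square algebra_simps)
  qed
  have "D b - C * P b \<le> D a - C * P a"
    by (rule nonincreasing_if_increments_le_quadratic[of a b "\<lambda>\<tau>. D \<tau> - C * P \<tau>" "3 * V * C"])
       (use D_incr \<open>a < b\<close> in \<open>force simp: algebra_simps abs_le_iff\<close>)+
  moreover have "- D b - C * P b \<le> - D a - C * P a"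
    by (rule nonincreasing_if_increments_le_quadratic[of a b "\<lambda>\<tau>. - D \<tau> - C * P \<tau>" "3 * V * C"])
       (use D_incr \<open>a < b\<close> in \<open>force simp: algebra_simps abs_le_iff\<close>)+
  moreover have "D a = 0" "P a = 0" by (simp_all add: D_def U_def P_def)
  ultimately have "\<bar>D b\<bar> \<le> C * P b" by simp
  moreover have "P b = V * (b - a)\<^sup>2 / 3"
    using \<open>a < b\<close> by (simp add: P_def power2_eq_square power3_eq_cube field_simps)
  ultimately show ?thesis
    using \<open>U b = 0\<close> by (simp add: D_def u_def)
qed

section \<open>Solutions of input-affine systems\<close>

lemma absolutely_continuous_fun_subinterval:
  assumes "absolutely_continuous_fun a b x" "a \<le> c" "d \<le> b"
  shows "absolutely_continuous_fun c d x"
  unfolding absolutely_continuous_fun_def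
proof (intro allI impI)
  fix \<epsilon> :: real assume "0 < \<epsilon>"
  then obtain \<delta> where "0 < \<delta>" and \<delta>: "\<And>(I :: nat set) l u.
       finite I \<Longrightarrow> (\<And>i. i \<in> I \<Longrightarrow> a \<le> l i \<and> l i \<le> u i \<and> u i \<le> b) \<Longrightarrow>
       disjoint_family_on (\<lambda>i. {l i<..<u i}) I \<Longrightarrow> (\<Sum>i\<in>I. u i - l i) < \<delta> \<Longrightarrow>
       (\<Sum>i\<in>I. norm (x (u i) - x (l i))) < \<epsilon>"
    by (rule absolutely_continuous_fun_finite_familyE[OF assms(1)]) blast
  show "\<exists>\<delta>>0. \<forall>(I :: nat set) l u.
        finite I \<and> (\<forall>i\<in>I. c \<le> l i \<and> l i \<le> u i \<and> u i \<le> d) \<and>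
        disjoint_family_on (\<lambda>i. {l i<..<u i}) I \<and> (\<Sum>i\<in>I. u i - l i) < \<delta>
        \<longrightarrow> (\<Sum>i\<in>I. norm (x (u i) - x (l i))) < \<epsilon>"
  proof (intro exI conjI allI impI; (elim conjE)?)
    fix I :: "nat set" and l u
    assume "\<forall>i\<in>I. c \<le> l i \<and> l i \<le> u i \<and> u i \<le> d"
    then have "a \<le> l i \<and> l i \<le> u i \<and> u i \<le> b" if "i \<in> I" for i
      using that assms(2,3) order_trans by blast
    moreover assume "finite I" "disjoint_family_on (\<lambda>i. {l i<..<u i}) I" "(\<Sum>i\<in>I. u i - l i) < \<delta>"
    ultimately show "(\<Sum>i\<in>I. norm (x (u i) - x (l i))) < \<epsilon>" using \<delta> by blast
  qed fact
qed

lemma absolutely_continuous_fun_imp_continuous_on: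
  assumes "absolutely_continuous_fun a b x"
  shows "continuous_on {a..b} x"
  unfolding continuous_on_iff
proof (intro ballI allI impI)
  fix r \<epsilon> :: real assume r: "r \<in> {a..b}" and "0 < \<epsilon>"
  from \<open>0 < \<epsilon>\<close> obtain \<delta> where "0 < \<delta>" and \<delta>: "\<And>(I :: unit set) l u.
       finite I \<Longrightarrow> (\<And>i. i \<in> I \<Longrightarrow> a \<le> l i \<and> l i \<le> u i \<and> u i \<le> b) \<Longrightarrow>
       disjoint_family_on (\<lambda>i. {l i<..<u i}) I \<Longrightarrow> (\<Sum>i\<in>I. u i - l i) < \<delta> \<Longrightarrow>
       (\<Sum>i\<in>I. norm (x (u i) - x (l i))) < \<epsilon>"
    by (rule absolutely_continuous_fun_finite_familyE[OF assms]) blast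
  have "dist (x s) (x r) < \<epsilon>" if "s \<in> {a..b}" "dist s r < \<delta>" for s
  proof (cases r s rule: le_cases)
    case le
    then have "(\<Sum>i\<in>(UNIV :: unit set). norm (x s - x r)) < \<epsilon>"
      using r that by (intro \<delta>) (auto simp: disjoint_family_on_def dist_norm)
    then show ?thesis by (simp add: dist_norm)
  next
    case ge
    then have "(\<Sum>i\<in>(UNIV :: unit set). norm (x r - x s)) < \<epsilon>"
      using r that by (intro \<delta>) (auto simp: disjoint_family_on_def dist_norm)
    then show ?thesis by (simp add: dist_norm norm_minus_commute)
  qed
  then show "\<exists>\<delta>>0. \<forall>s\<in>{a..b}. dist s r < \<delta> \<longrightarrow> dist (x s) (x r) < \<epsilon>"
    using \<open>0 < \<delta>\<close> by blast
qed

lemma input_affine_solution_has_integral: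
  assumes sol: "input_affine_solution f m g v a b x" and cd: "a \<le> c" "c \<le> d" "d \<le> b"
  shows "((\<lambda>s. f (x s) + (\<Sum>i=1..m. v i s *\<^sub>R g i (x s))) has_integral (x d - x c)) {c..d}"
proof -
  let ?F = "\<lambda>s. f (x s) + (\<Sum>i=1..m. v i s *\<^sub>R g i (x s))"
  have "AE s in lebesgue. s \<in> {a..b} \<longrightarrow> (x has_vector_derivative ?F s) (at s within {a..b})"
    using sol by (simp add: input_affine_solution_def AE_restrict_space_iff)
  then obtain S where S: "S \<in> null_sets lebesgue"
    "\<And>s. s \<in> {a..b} - S \<Longrightarrow> (x has_vector_derivative ?F s) (at s within {a..b})"
    by (auto simp: eventually_ae_filter)
  show ?thesis
  proof (rule absolutely_continuous_has_integral_derivative[OF _ \<open>c \<le> d\<close>])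
    show "absolutely_continuous_fun c d x"
      using sol cd by (auto simp: input_affine_solution_def intro: absolutely_continuous_fun_subinterval)
    show "negligible S" using S by (simp add: negligible_iff_null_sets)
    show "(x has_vector_derivative ?F s) (at s within {c..d})" if "s \<in> {c..d} - S" for s
      by (rule has_vector_derivative_within_subset[OF S(2)]) (use that cd in auto)
  qed
qed

lemma input_affine_solution_has_integral_component:
  assumes "input_affine_solution f m g v a b x" "a \<le> c" "c \<le> d" "d \<le> b"
  shows "((\<lambda>s. f (x s) $ j + (\<Sum>i=1..m. v i s * g i (x s) $ j)) has_integral (x d - x c) $ j) {c..d}"
  using has_integral_linear[OF input_affine_solution_has_integral[OF assms] bounded_linear_vec_nth[of j]]
  by (simp add: o_def)

lemma input_affine_solution_continuous_on:
  "input_affine_solution f m g v a b x \<Longrightarrow> continuous_on {a..b} x"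
  by (simp add: input_affine_solution_def absolutely_continuous_fun_imp_continuous_on)

lemma abs_sum_inputs_le:
  assumes "\<And>i. i \<in> {1..m} \<Longrightarrow> \<bar>v i\<bar> \<le> V i" "\<And>i. i \<in> {1..m} \<Longrightarrow> \<bar>q i\<bar> \<le> M i"
  shows "\<bar>\<Sum>i=1..m. v i * q i\<bar> \<le> (\<Sum>i=1..m. V i * M i :: real)"
proof -
  have "\<bar>\<Sum>i=1..m. v i * q i\<bar> \<le> (\<Sum>i=1..m. \<bar>v i * q i\<bar>)" by (rule sum_abs)
  also have "\<dots> \<le> (\<Sum>i=1..m. V i * M i)"
  proof (rule sum_mono)
    fix i assume i: "i \<in> {1..m}"
    then show "\<bar>v i * q i\<bar> \<le> V i * M i"
      using assms[OF i] unfolding abs_mult by (intro mult_mono) auto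
  qed
  finally show ?thesis .
qed

text \<open>
  A solution moves with speed at most $K + K'$. Applied to the auxiliary solution \<open>y\<close> this makes
  each $g_i \circ y$ Lipschitz, as the treatment of the centred inputs requires.
\<close>

lemma input_affine_solution_Lipschitz:
  fixes x :: "real \<Rightarrow> real ^ 'n"
  assumes sol: "input_affine_solution f m g v a b x" "a \<le> c" "c \<le> d" "d \<le> b"
    and v: "\<And>s i. s \<in> {a..b} \<Longrightarrow> i \<in> {1..m} \<Longrightarrow> \<bar>v i s\<bar> \<le> V i"
    and f: "\<And>s. s \<in> {a..b} \<Longrightarrow> infnorm (f (x s)) \<le> K"
    and g: "\<And>s i. s \<in> {a..b} \<Longrightarrow> i \<in> {1..m} \<Longrightarrow> infnorm (g i (x s)) \<le> K\<^sub>g i"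
  shows "infnorm (x d - x c) \<le> (K + (\<Sum>i=1..m. V i * K\<^sub>g i)) * (d - c)"
  unfolding infnorm_le_iff_components
proof
  fix j
  let ?F = "\<lambda>s. f (x s) $ j + (\<Sum>i=1..m. v i s * g i (x s) $ j)"
  have int: "(?F has_integral (x d - x c) $ j) {c..d}"
    by (rule input_affine_solution_has_integral_component[OF sol])
  have "\<bar>integral {c..d} ?F\<bar> \<le> (K + (\<Sum>i=1..m. V i * K\<^sub>g i)) * (d - c)"
  proof (rule abs_integral_le)
    show "?F integrable_on {c..d}" using int by blast
    fix s assume "s \<in> {c..d}"
    then have s: "s \<in> {a..b}" using sol by auto
    have "\<bar>f (x s) $ j\<bar> \<le> K"
      using f[OF s] infnorm_le_iff_components by blast
    moreover have "\<bar>\<Sum>i=1..m. v i s * g i (x s) $ j\<bar> \<le> (\<Sum>i=1..m. V i * K\<^sub>g i)"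
      using v[OF s] g[OF s] infnorm_le_iff_components by (intro abs_sum_inputs_le) blast+
    ultimately show "\<bar>?F s\<bar> \<le> K + (\<Sum>i=1..m. V i * K\<^sub>g i)" by linarith
  qed (use sol in simp)
  then show "\<bar>(x d - x c) $ j\<bar> \<le> (K + (\<Sum>i=1..m. V i * K\<^sub>g i)) * (d - c)"
    using integral_unique[OF int] by simp
qed

text \<open>
  The first-order estimate. Each of the two input terms is bounded by $K'$, so their
  difference perturbs the velocity $f(x) - f(y)$ by
  at most $2K'$.
\<close>

lemma infnorm_diff_solutions_le_growth:
  fixes f :: "real ^ 'n \<Rightarrow> real ^ 'n"
  assumes f: "\<And>z. f differentiable (at z)" and "convex B"
    and x: "input_affine_solution f m g v a b x" "\<And>s. s \<in> {a..b} \<Longrightarrow> x s \<in> B"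
    and y: "input_affine_solution f m g w a b y" "\<And>s. s \<in> {a..b} \<Longrightarrow> y s \<in> B"
    and "x a = y a"
    and v: "\<And>s i. s \<in> {a..b} \<Longrightarrow> i \<in> {1..m} \<Longrightarrow> \<bar>v i s\<bar> \<le> V i"
    and w: "\<And>s i. s \<in> {a..b} \<Longrightarrow> i \<in> {1..m} \<Longrightarrow> \<bar>w i s\<bar> \<le> V i"
    and g: "\<And>z i. z \<in> B \<Longrightarrow> i \<in> {1..m} \<Longrightarrow> infnorm (g i z) \<le> K\<^sub>g i"
    and \<Lambda>: "\<And>z. z \<in> B \<Longrightarrow> log_norm (jacobian f (at z)) \<le> \<Lambda>"
    and s: "s \<in> {a..b}"
  shows "infnorm (x s - y s) \<le> 2 * (\<Sum>i=1..m. V i * K\<^sub>g i) * growth \<Lambda> (s - a)"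
proof (rule infnorm_le_growth[of a b "\<lambda>s. x s - y s" "\<lambda>s. f (x s) - f (y s)"])
  let ?K' = "\<Sum>i=1..m. V i * K\<^sub>g i"
  have contf: "continuous_on UNIV f"
    using f by (simp add: continuous_on_eq_continuous_at differentiable_imp_continuous_within)
  have contx: "continuous_on {a..b} x" and conty: "continuous_on {a..b} y"
    using x y input_affine_solution_continuous_on by blast+
  then show "continuous_on {a..b} (\<lambda>s. x s - y s)" by (intro continuous_intros)
  show cont\<phi>: "continuous_on {a..b} (\<lambda>s. f (x s) - f (y s))"
    by (intro continuous_intros continuous_on_compose2[OF contf] contx conty) auto
  have gv: "\<bar>\<Sum>i=1..m. v i s * g i (x s) $ j\<bar> \<le> ?K'" "\<bar>\<Sum>i=1..m. w i s * g i (y s) $ j\<bar> \<le> ?K'"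
    if "s \<in> {a..b}" for s j
    by (intro abs_sum_inputs_le v w order_trans[OF component_le_infnorm_cart g] x(2) y(2) that; assumption)+
  show "0 \<le> 2 * ?K'" using order_trans[OF abs_ge_zero gv(1)[OF s]] by simp
  show "sgn ((x s - y s) $ j) * (f (x s) - f (y s)) $ j \<le> \<Lambda> * infnorm (x s - y s)"
    if "s \<in> {a..b}" "infnorm (x s - y s) = \<bar>(x s - y s) $ j\<bar>" for s j
    using component_diff_le_one_sided_Lipschitz[OF f \<open>convex B\<close> x(2) y(2) \<Lambda>] that by auto
  fix c d j assume cd: "a \<le> c" "c \<le> d" "d \<le> b"
  let ?r = "\<lambda>s. (\<Sum>i=1..m. v i s * g i (x s) $ j) - (\<Sum>i=1..m. w i s * g i (y s) $ j)"
  have "(\<lambda>s. (f (x s) - f (y s)) $ j) integrable_on {c..d}"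
    using cd by (intro integrable_continuous_real continuous_on_subset[OF cont\<phi>] continuous_intros) auto
  then have \<phi>: "((\<lambda>s. (f (x s) - f (y s)) $ j) has_integral integral {c..d} (\<lambda>s. (f (x s) - f (y s)) $ j)) {c..d}"
    by blast
  have r: "(?r has_integral (x d - y d - (x c - y c)) $ j - integral {c..d} (\<lambda>s. (f (x s) - f (y s)) $ j)) {c..d}"
    using has_integral_diff[OF has_integral_diff[OF input_affine_solution_has_integral_component[OF x(1) cd, of j]
          input_affine_solution_has_integral_component[OF y(1) cd, of j]] \<phi>]
    by (simp add: algebra_simps)
  have "\<bar>integral {c..d} ?r\<bar> \<le> (2 * ?K') * (d - c)"
  proof (rule abs_integral_le)
    show "?r integrable_on {c..d}" using r by blast
    show "\<bar>?r s\<bar> \<le> 2 * ?K'" if "s \<in> {c..d}" for s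
      using gv[of s j] that cd by auto
  qed (use cd in simp)
  then show "\<bar>(x d - y d - (x c - y c)) $ j - integral {c..d} (\<lambda>s. (f (x s) - f (y s)) $ j)\<bar> \<le> 2 * ?K' * (d - c)"
    by (simp only: integral_unique[OF r])
qed (use \<open>x a = y a\<close> s in auto)

section \<open>The local error of averaging the inputs\<close>

text \<open>
  The second-order estimate on a single interval. The integral of the velocity of \<open>x - y\<close> is split
  into the part \<open>D\<close>, which vanishes where \<open>x\<close> and \<open>y\<close> agree and is controlled by the
  first-order estimate, and the parts \<open>W i\<close>, which carry the centred inputs.
\<close>

theorem infnorm_diff_averaged_input_le:
  fixes f :: "real ^ 'n \<Rightarrow> real ^ 'n" and x y :: "real \<Rightarrow> real ^ 'n"
  assumes K'_def: "K' = (\<Sum>i=1..m. V i * K\<^sub>g i)" and L'_def: "L' = (\<Sum>i=1..m. V i * L\<^sub>g i)"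
    and "a < b" "convex B"
    and f: "\<And>z. f differentiable (at z)"
    and g: "\<And>z i. i \<in> {1..m} \<Longrightarrow> g i differentiable (at z)"
    and v_meas: "\<And>i. i \<in> {1..m} \<Longrightarrow> v i \<in> borel_measurable (lebesgue_on {a..b})"
    and v: "\<And>s i. s \<in> {a..b} \<Longrightarrow> i \<in> {1..m} \<Longrightarrow> \<bar>v i s\<bar> \<le> V i"
    and w: "\<And>i. i \<in> {1..m} \<Longrightarrow> w i = 1 / (b - a) * integral {a..b} (v i)"
    and x: "input_affine_solution f m g v a b x" "\<And>s. s \<in> {a..b} \<Longrightarrow> x s \<in> B"
    and y: "input_affine_solution f m g (\<lambda>i s. w i) a b y" "\<And>s. s \<in> {a..b} \<Longrightarrow> y s \<in> B"
    and "x a = y a"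
    and K: "\<And>z. z \<in> B \<Longrightarrow> infnorm (f z) \<le> K"
    and K\<^sub>g: "\<And>z i. z \<in> B \<Longrightarrow> i \<in> {1..m} \<Longrightarrow> infnorm (g i z) \<le> K\<^sub>g i"
    and \<Lambda>: "\<And>z. z \<in> B \<Longrightarrow> log_norm (jacobian f (at z)) \<le> \<Lambda>"
    and L: "\<And>z. z \<in> B \<Longrightarrow> mat_infnorm (jacobian f (at z)) \<le> L"
    and L\<^sub>g: "\<And>z i. z \<in> B \<Longrightarrow> i \<in> {1..m} \<Longrightarrow> mat_infnorm (jacobian (g i) (at z)) \<le> L\<^sub>g i"
  shows "infnorm (x b - y b) \<le> (b - a)\<^sup>2 * ((K + K') * L' / 3 + 2 * K' * (L + L') * phi (\<Lambda> * (b - a)))"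
  unfolding infnorm_le_iff_components
proof
  fix j
  have v_int: "v i integrable_on {a..b}" if "i \<in> {1..m}" for i
    using integrable_bounded_measurable_times_continuous[OF v_meas[OF that] v[OF _ that], of "\<lambda>_. 1"]
    by auto
  have w_le: "\<bar>w i\<bar> \<le> V i" if "i \<in> {1..m}" for i
    using abs_integral_le[OF v_int[OF that] _ v[OF _ that]] \<open>a < b\<close>
    by (simp add: w[OF that] abs_mult pos_divide_le_eq)
  have L_nonneg: "0 \<le> L" "i \<in> {1..m} \<Longrightarrow> 0 \<le> L\<^sub>g i" for i
    using order_trans[OF mat_infnorm_nonneg L[OF x(2)[of a]]]
      order_trans[OF mat_infnorm_nonneg L\<^sub>g[OF x(2)[of a]]] \<open>a < b\<close> by auto
  have V_nonneg: "0 \<le> V i" if "i \<in> {1..m}" for i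
    using w_le[OF that] by linarith
  have "0 \<le> K'"
    unfolding K'_def using \<open>a < b\<close>
    by (intro sum_nonneg mult_nonneg_nonneg V_nonneg order_trans[OF infnorm_pos_le K\<^sub>g[OF x(2)[of a]]]) auto
  define E where "E = 2 * K' * growth \<Lambda> (b - a)"
  have E: "infnorm (x s - y s) \<le> E" if s: "s \<in> {a..b}" for s
  proof -
    have "infnorm (x s - y s) \<le> 2 * K' * growth \<Lambda> (s - a)"
      unfolding K'_def
      by (rule infnorm_diff_solutions_le_growth[OF f \<open>convex B\<close> x y \<open>x a = y a\<close> v w_le K\<^sub>g \<Lambda> s])
    also have "\<dots> \<le> E"
      unfolding E_def using s \<open>0 \<le> K'\<close> by (intro mult_left_mono growth_mono) auto
    finally show ?thesis .
  qed
  have contg: "continuous_on {a..b} (\<lambda>s. g i (z s) $ j)"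
    if "continuous_on {a..b} z" "i \<in> {1..m}" for z i
  proof -
    have "continuous_on UNIV (g i)"
      using g[OF that(2)] by (simp add: continuous_on_eq_continuous_at differentiable_imp_continuous_within)
    then show ?thesis
      by (intro continuous_intros continuous_on_compose2[OF _ that(1)]) auto
  qed
  have contx: "continuous_on {a..b} x" and conty: "continuous_on {a..b} y"
    using x y input_affine_solution_continuous_on by blast+
  let ?W = "\<lambda>i s. (v i s - w i) * g i (y s) $ j"
  let ?D = "\<lambda>s. f (x s) $ j - f (y s) $ j + (\<Sum>i=1..m. v i s * (g i (x s) - g i (y s)) $ j)"
  have W_int: "?W i integrable_on {a..b}" if "i \<in> {1..m}" for i
  proof (rule integrable_bounded_measurable_times_continuous)
    show "(\<lambda>s. v i s - w i) \<in> borel_measurable (lebesgue_on {a..b})"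
      using v_meas[OF that] by simp
    show "\<bar>v i s - w i\<bar> \<le> 2 * V i" if "s \<in> {a..b}" for s
      using v[OF that \<open>i \<in> {1..m}\<close>] w_le[OF \<open>i \<in> {1..m}\<close>] by simp
  qed (rule contg[OF conty that])
  have sum_W_int: "((\<lambda>s. \<Sum>i=1..m. ?W i s) has_integral (\<Sum>i=1..m. integral {a..b} (?W i))) {a..b}"
    by (intro has_integral_sum) (use W_int in auto)
  have "(x b - y b) $ j = (x b - x a) $ j - (y b - y a) $ j"
    using \<open>x a = y a\<close> by simp
  moreover have "((\<lambda>s. ?D s + (\<Sum>i=1..m. ?W i s)) has_integral (x b - x a) $ j - (y b - y a) $ j) {a..b}"
    using has_integral_diff[OF input_affine_solution_has_integral_component[OF x(1), of a b j]
        input_affine_solution_has_integral_component[OF y(1), of a b j]] \<open>a < b\<close>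
    by (simp add: algebra_simps sum.distrib sum_subtractf)
  ultimately have "((\<lambda>s. ?D s + (\<Sum>i=1..m. ?W i s)) has_integral (x b - y b) $ j) {a..b}"
    by (simp only:)
  from has_integral_diff[OF this sum_W_int]
  have D_int: "(?D has_integral (x b - y b) $ j - (\<Sum>i=1..m. integral {a..b} (?W i))) {a..b}"
    by simp
  have "\<bar>integral {a..b} ?D\<bar> \<le> ((L + L') * E) * (b - a)"
  proof (rule abs_integral_le)
    show "?D integrable_on {a..b}" using D_int by blast
    fix s assume s: "s \<in> {a..b}"
    have "infnorm (f (x s) - f (y s)) \<le> L * infnorm (x s - y s)"
      by (rule infnorm_diff_le_Lipschitz[OF f \<open>convex B\<close> x(2)[OF s] y(2)[OF s] L])
    also have "\<dots> \<le> L * E" using E[OF s] L_nonneg by (intro mult_left_mono)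
    finally have 1: "\<bar>(f (x s) - f (y s)) $ j\<bar> \<le> L * E"
      by (rule order_trans[OF component_le_infnorm_cart])
    have "\<bar>\<Sum>i=1..m. v i s * (g i (x s) - g i (y s)) $ j\<bar> \<le> (\<Sum>i=1..m. V i * (L\<^sub>g i * E))"
    proof (rule abs_sum_inputs_le[OF v[OF s]])
      fix i assume i: "i \<in> {1..m}"
      have "infnorm (g i (x s) - g i (y s)) \<le> L\<^sub>g i * infnorm (x s - y s)"
        by (rule infnorm_diff_le_Lipschitz[OF g[OF i] \<open>convex B\<close> x(2)[OF s] y(2)[OF s] L\<^sub>g[OF _ i]])
      also have "\<dots> \<le> L\<^sub>g i * E" using E[OF s] L_nonneg(2)[OF i] by (intro mult_left_mono)
      finally show "\<bar>(g i (x s) - g i (y s)) $ j\<bar> \<le> L\<^sub>g i * E"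
        by (rule order_trans[OF component_le_infnorm_cart])
    qed
    also have "\<dots> = L' * E"
      by (simp add: L'_def sum_distrib_right mult.assoc)
    finally show "\<bar>?D s\<bar> \<le> (L + L') * E"
      using 1 by (simp only: distrib_right vector_minus_component)
  qed (use \<open>a < b\<close> in simp)
  moreover have "\<bar>\<Sum>i=1..m. integral {a..b} (?W i)\<bar> \<le> (K + K') * L' / 3 * (b - a)\<^sup>2"
  proof -
    have W: "\<bar>integral {a..b} (?W i)\<bar> \<le> (L\<^sub>g i * (K + K')) * V i * (b - a)\<^sup>2 / 3" if i: "i \<in> {1..m}" for i
    proof (rule integral_Lipschitz_mult_centred[OF \<open>a < b\<close> v_meas[OF i] v[OF _ i] w[OF i]])
      have mono: "\<bar>g i (y s) $ j - g i (y r) $ j\<bar> \<le> L\<^sub>g i * (K + K') * \<bar>s - r\<bar>"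
        if "a \<le> r" "r \<le> s" "s \<le> b" for r s
      proof -
        have "infnorm (g i (y s) - g i (y r)) \<le> L\<^sub>g i * infnorm (y s - y r)"
          using that by (intro infnorm_diff_le_Lipschitz[OF g[OF i] \<open>convex B\<close> _ _ L\<^sub>g[OF _ i]] y(2)) auto
        also have "\<dots> \<le> L\<^sub>g i * ((K + K') * (s - r))"
          unfolding K'_def using L_nonneg(2)[OF i] that
          by (intro mult_left_mono input_affine_solution_Lipschitz[OF y(1)] w_le K K\<^sub>g y(2)) auto
        finally have "infnorm (g i (y s) - g i (y r)) \<le> L\<^sub>g i * (K + K') * \<bar>s - r\<bar>"
          using that by (simp add: mult.assoc)
        then show ?thesis
          unfolding infnorm_le_iff_components by simp
      qed
      show "\<bar>g i (y s) $ j - g i (y r) $ j\<bar> \<le> L\<^sub>g i * (K + K') * \<bar>s - r\<bar>"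
        if "r \<in> {a..b}" "s \<in> {a..b}" for r s
        using mono[of r s] mono[of s r] that
        by (cases "r \<le> s") (auto simp: abs_minus_commute)
    qed
    have "\<bar>\<Sum>i=1..m. integral {a..b} (?W i)\<bar> \<le> (\<Sum>i=1..m. \<bar>integral {a..b} (?W i)\<bar>)"
      by (rule sum_abs)
    also have "\<dots> \<le> (\<Sum>i=1..m. (L\<^sub>g i * (K + K')) * V i * (b - a)\<^sup>2 / 3)"
      by (intro sum_mono W)
    also have "\<dots> = (K + K') * L' / 3 * (b - a)\<^sup>2"
      by (simp add: L'_def sum_distrib_left sum_distrib_right sum_divide_distrib mult_ac)
    finally show ?thesis .
  qed
  ultimately have "\<bar>(x b - y b) $ j\<bar> \<le> ((L + L') * E) * (b - a) + (K + K') * L' / 3 * (b - a)\<^sup>2"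
    using integral_unique[OF D_int] by linarith
  also have "\<dots> = (b - a)\<^sup>2 * ((K + K') * L' / 3 + 2 * K' * (L + L') * phi (\<Lambda> * (b - a)))"
    by (simp add: E_def growth_def power2_eq_square algebra_simps)
  finally show "\<bar>(x b - y b) $ j\<bar>
      \<le> (b - a)\<^sup>2 * ((K + K') * L' / 3 + 2 * K' * (L + L') * phi (\<Lambda> * (b - a)))" .
qed

text \<open>
  The interval \<open>{t k..t (Suc k)}\<close> lies in \<open>{0..T}\<close>, so the inputs are measurable and bounded on it,
  and their Lebesgue means are the gauge integral means of the one-interval estimate.
\<close>

theorem theorem7:
  fixes f :: "real ^ 'n \<Rightarrow> real ^ 'n"
    and g :: "nat \<Rightarrow> real ^ 'n \<Rightarrow> real ^ 'n"
    and m N k :: nat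
    and V K\<^sub>g L\<^sub>g w :: "nat \<Rightarrow> real"
    and v :: "nat \<Rightarrow> real \<Rightarrow> real"
    and t :: "nat \<Rightarrow> real"
    and T h K L \<Lambda> K' L' :: real
    and p q :: "real ^ 'n"
    and B :: "(real ^ 'n) set"
    and x y :: "real \<Rightarrow> real ^ 'n"
  assumes partition: "t 0 = 0" "t N = T" "\<And>j. j < N \<Longrightarrow> t j < t (Suc j)"
    and k: "k < N"
    and h: "h = t (Suc k) - t k"
    and C1: "C1_vector_function f" "\<And>i. i \<in> {1..m} \<Longrightarrow> C1_vector_function (g i)"
    and V_pos: "\<And>i. i \<in> {1..m} \<Longrightarrow> V i > 0"
    and v: "admissible_inputs {0..T} m V v"
    and w: "\<And>i. i \<in> {1..m} \<Longrightarrow>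
              w i = 1 / h * integral\<^sup>L (lebesgue_on {t k..t (Suc k)}) (v i)"
    and x_sol: "input_affine_solution f m g v (t k) (t (Suc k)) x"
    and y_sol: "input_affine_solution f m g (\<lambda>i s. w i) (t k) (t (Suc k)) y"
    and initial: "x (t k) = y (t k)"
    and box: "B = cbox p q"
    and x_in_B: "\<And>s. s \<in> {t k..t (Suc k)} \<Longrightarrow> x s \<in> B"
    and y_in_B: "\<And>s. s \<in> {t k..t (Suc k)} \<Longrightarrow> y s \<in> B"
    and f_bound: "\<And>z. z \<in> B \<Longrightarrow> infnorm (f z) \<le> K"
    and g_bound: "\<And>z i. z \<in> B \<Longrightarrow> i \<in> {1..m} \<Longrightarrow> infnorm (g i z) \<le> K\<^sub>g i"
    and Df_log_norm: "\<And>z. z \<in> B \<Longrightarrow> log_norm (jacobian f (at z)) \<le> \<Lambda>"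
    and Df_bound: "\<And>z. z \<in> B \<Longrightarrow> mat_infnorm (jacobian f (at z)) \<le> L"
    and Dg_bound: "\<And>z i. z \<in> B \<Longrightarrow> i \<in> {1..m} \<Longrightarrow> mat_infnorm (jacobian (g i) (at z)) \<le> L\<^sub>g i"
    and K': "K' = (\<Sum>i=1..m. V i * K\<^sub>g i)"
    and L': "L' = (\<Sum>i=1..m. V i * L\<^sub>g i)"
  shows "infnorm (x (t (Suc k)) - y (t (Suc k)))
           \<le> h\<^sup>2 * ((K + K') * L' / 3 + 2 * K' * (L + L') * phi (\<Lambda> * h))"
proof -
  have t_mono: "t i \<le> t j" if "i \<le> j" "j \<le> N" for i j
    using that
  proof (induction j rule: dec_induct)
    case (step j)
    then show ?case using partition(3)[of j] by simp
  qed simp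
  have sub: "{t k..t (Suc k)} \<subseteq> {0..T}"
    using t_mono[of 0 k] t_mono[of "Suc k" N] k partition by auto
  have less: "t k < t (Suc k)" using k partition(3) by simp
  have v_meas: "v i \<in> borel_measurable (lebesgue_on {t k..t (Suc k)})" if "i \<in> {1..m}" for i
    using v that sub unfolding admissible_inputs_def by (blast intro: measurable_restrict_mono)
  have v_le: "\<bar>v i s\<bar> \<le> V i" if "s \<in> {t k..t (Suc k)}" "i \<in> {1..m}" for i s
  proof -
    have "v i s \<in> {- V i..V i}"
      using v that sub unfolding admissible_inputs_def by blast
    then show ?thesis by auto
  qed
  have w_eq: "w i = 1 / (t (Suc k) - t k) * integral {t k..t (Suc k)} (v i)" if "i \<in> {1..m}" for i
  proof -
    have "(\<lambda>s. v i s * 1) absolutely_integrable_on {t k..t (Suc k)}"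
      by (rule absolutely_integrable_bounded_measurable_times_continuous[OF v_meas[OF that] v_le[OF _ that]]) auto
    then have "integrable (lebesgue_on {t k..t (Suc k)}) (v i)"
      by (intro absolutely_integrable_imp_integrable) auto
    then show ?thesis
      using w[OF that] h by (simp add: lebesgue_integral_eq_integral)
  qed
  show ?thesis
    unfolding h
  proof (rule infnorm_diff_averaged_input_le[where f = f and g = g and v = v and w = w and B = B])
    show "convex B" by (simp add: box)
    show "f differentiable (at z)" for z
      using C1(1) by (simp add: C1_vector_function_def)
    show "g i differentiable (at z)" if "i \<in> {1..m}" for i z
      using C1(2)[OF that] by (simp add: C1_vector_function_def)
  qed (fact K' L' less v_meas v_le w_eq x_sol x_in_B y_sol y_in_B initial f_bound g_bound Df_log_norm
      Df_bound Dg_bound)+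
qed

end
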